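(* Assume: (i) $F$ is bounded from below, strictly convex and Fréchet differentiable on $Y$, and $\nabla F:Y\to Y$ is Lipschitz continuous on compact subsets of $Y$; (ii) for every $\alpha\ge 0$ the sublevel set $\{u\in\mathcal M : \mathcal G(u)\le\alpha\}$ is weak* compact; (iii) whenever $\{u_k\}_k\subset\operatorname{dom}(\mathcal G)$ and $u_k\rightharpoonup^* u$ for some $u\in\mathcal M$, then $Ku_k\to Ku$ strongly in $Y$. Then the functional $j(\mu)=F(\mathcal K\mu)+\|\mu\|_{M(\mathcal B)}$ on $M^+(\mathcal B)$ is weak* lower semicontinuous, has weak* compact sublevel sets, and the problem $\inf_{\mu\in M^+(\mathcal B)}j(\mu)$ admits at least one solution. In addition: (a) if $\bar u\in\mathcal M$ minimizes $J$ over $\mathcal M$, there exists a minimizer $\bar\mu\in M^+(\mathcal B)$ of $j$ over $M^+(\mathcal B)$ such that $\bar u=\mathcal I(\bar\mu)$; (b) if $\bar\mu\in M^+(\mathcal B)$ minimizes $j$ over $M^+(\mathcal B)$, then $\bar u:=\mathcal I(\bar\mu)$ minimizes $J$ over $\mathcal M$. In particular $\min_{u\in\mathcal M}J(u)=\min_{\mu\in M^+(\mathcal B)}j(\mu)$.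
   Context: Setting: $\mathcal C$ is a separable real Banach space, $\mathcal M=\mathcal C^*$ its topological dual with the dual norm, $\langle p,u\rangle$ denotes the duality pairing of $p\in\mathcal C$, $u\in\mathcal M$. $Y$ is a real Hilbert space, $F:Y\to\mathbb R$ is convex, $K:\mathcal M\to Y$ is linear and weak*-to-weak continuous. $\mathcal G:\mathcal M\to[0,\infty]$ is convex, weak* lower semicontinuous and positively one-homogeneous ($\mathcal G(\lambda u)=\lambda\mathcal G(u)$ for $\lambda\ge0$). $J(u)=F(Ku)+\mathcal G(u)$; $\operatorname{dom}(\mathcal G)=\{u:\mathcal G(u)<\infty\}$; $B=\{u\in\mathcal M:\mathcal G(u)\le1\}$; $\operatorname{Ext}(B)$ is the set of extremal points of $B$; $\mathcal B=\overline{\operatorname{Ext}(B)}^{*}$ is its weak* closure, a compact metrizable space in the weak* topology. $M(\mathcal B)=C(\mathcal B)^*$ is the space of finite (signed) Radon measures on $\mathcal B$ with the total variation norm, $M^+(\mathcal B)$ its cone of positive measures; weak* refers to the duality with $C(\mathcal B)$. $\mathcal I:M^+(\mathcal B)\to\operatorname{dom}(\mathcal G)$ is the (well-defined) map determined by $\langle p,\mathcal I(\mu)\rangle=\int_{\mathcal B}\langle p,v\rangle\,d\mu(v)$ for all $p\in\mathcal C$. $\mathcal K:M(\mathcal B)\to Y$ is the (well-defined) linear continuous operator determined by $(\mathcal K\mu,y)_Y=\int_{\mathcal B}(Kv,y)_Y\,d\mu(v)$ for all $y\in Y$. *)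

theory Defs
  imports "HOL-Analysis.Analysis"
begin

text \<open>
  The dual of a real Banach space of type \<open>'c\<close> is the type of bounded linear functionals
  \<open>'c \<Rightarrow>\<^sub>L real\<close>.  The strong operator topology of the library is the topology of pointwise
  convergence on \<open>'c\<close>, which for real-valued operators is the weak* topology.
\<close>

abbreviation weak_star :: "('c::real_normed_vector \<Rightarrow>\<^sub>L real) topology" where
  "weak_star \<equiv> strong_operator_topology"

text \<open>The weak topology of a Hilbert space: functionals are represented by inner products.\<close>

definition weak_topology :: "'y::real_inner topology" where
  "weak_topology = pullback_topology UNIV (\<lambda>z y. z \<bullet> y) (product_topology (\<lambda>_. euclideanreal) UNIV)"

definition lsc_on_topology :: "'a topology \<Rightarrow> ('a \<Rightarrow> 'b::linorder) \<Rightarrow> bool" where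
  "lsc_on_topology X f \<longleftrightarrow> (\<forall>a. openin X {x \<in> topspace X. a < f x})"

definition ext_points :: "'a::real_vector set \<Rightarrow> 'a set" where
  "ext_points S = {x. x extreme_point_of S}"

definition borel_of_topology :: "'a topology \<Rightarrow> 'a measure" where
  "borel_of_topology X = sigma (topspace X) {U. openin X U}"

text \<open>
  The cone of finite positive Radon measures on a Hausdorff space.  Inner regularity of a finite
  measure with respect to compact sets entails outer regularity with respect to open sets.
\<close>

definition pos_radon_measures :: "'a topology \<Rightarrow> 'a measure set" where
  "pos_radon_measures X =
     {\<mu>. finite_measure \<mu> \<and> space \<mu> = topspace X \<and> sets \<mu> = sets (borel_of_topology X) \<and>
         (\<forall>A \<in> sets \<mu>. emeasure \<mu> A = (SUP C \<in> {C. C \<subseteq> A \<and> compactin X C}. emeasure \<mu> C))}"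

definition continuous_functions :: "'a topology \<Rightarrow> ('a \<Rightarrow> real) set" where
  "continuous_functions X = {\<phi>. continuous_map X euclideanreal \<phi>}"

text \<open>
  The trace on the positive cone of the weak* topology of \<open>C(X)\<^sup>*\<close>: the coarsest topology for which
  all the maps \<open>\<mu> \<mapsto> \<integral> \<phi> d\<mu>\<close> with \<open>\<phi> \<in> C(X)\<close> are continuous.
\<close>

definition weak_star_measures :: "'a topology \<Rightarrow> 'a measure topology" where
  "weak_star_measures X =
     pullback_topology (pos_radon_measures X)
       (\<lambda>\<mu>. \<lambda>\<phi> \<in> continuous_functions X. \<integral>x. \<phi> x \<partial>\<mu>)
       (product_topology (\<lambda>_. euclideanreal) (continuous_functions X))"

text \<open>The total variation norm, as a supremum over finite measurable partitions of the space.\<close>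

definition tv_norm :: "'a measure \<Rightarrow> real" where
  "tv_norm \<mu> = (SUP P \<in> {P. finite P \<and> partition_on (space \<mu>) P \<and> P \<subseteq> sets \<mu>}.
                    \<Sum>A\<in>P. \<bar>measure \<mu> A\<bar>)"

text \<open>The unit ball \<open>B\<close> of the regulariser and the weak* closure of its extremal points.\<close>

definition unit_sublevel :: "(('c::real_normed_vector \<Rightarrow>\<^sub>L real) \<Rightarrow> ennreal) \<Rightarrow> ('c \<Rightarrow>\<^sub>L real) set" where
  "unit_sublevel G = {u. G u \<le> 1}"

definition ext_closure :: "(('c::real_normed_vector \<Rightarrow>\<^sub>L real) \<Rightarrow> ennreal) \<Rightarrow> ('c \<Rightarrow>\<^sub>L real) set" where
  "ext_closure G = weak_star closure_of ext_points (unit_sublevel G)"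

definition ext_space :: "(('c::real_normed_vector \<Rightarrow>\<^sub>L real) \<Rightarrow> ennreal) \<Rightarrow> ('c \<Rightarrow>\<^sub>L real) topology" where
  "ext_space G = subtopology weak_star (ext_closure G)"

text \<open>
  The maps \<open>\<I>\<close> and \<open>\<K>\<close> (the latter restricted to positive measures) are given by the weak
  identities that determine them.
\<close>

definition calI :: "('c::real_normed_vector \<Rightarrow>\<^sub>L real) measure \<Rightarrow> ('c \<Rightarrow>\<^sub>L real)" where
  "calI \<mu> = (THE u. \<forall>p. blinfun_apply u p = (\<integral>v. blinfun_apply v p \<partial>\<mu>))"

definition calK ::
  "(('c::real_normed_vector \<Rightarrow>\<^sub>L real) \<Rightarrow> 'y::real_inner) \<Rightarrow> ('c \<Rightarrow>\<^sub>L real) measure \<Rightarrow> 'y" where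
  "calK K \<mu> = (THE z. \<forall>y. z \<bullet> y = (\<integral>v. K v \<bullet> y \<partial>\<mu>))"

definition J_fun ::
  "('y \<Rightarrow> real) \<Rightarrow> (('c::real_normed_vector \<Rightarrow>\<^sub>L real) \<Rightarrow> 'y) \<Rightarrow> (('c \<Rightarrow>\<^sub>L real) \<Rightarrow> ennreal) \<Rightarrow>
   ('c \<Rightarrow>\<^sub>L real) \<Rightarrow> ereal" where
  "J_fun F K G u = ereal (F (K u)) + enn2ereal (G u)"

definition j_fun ::
  "('y::real_inner \<Rightarrow> real) \<Rightarrow> (('c::real_normed_vector \<Rightarrow>\<^sub>L real) \<Rightarrow> 'y) \<Rightarrow>
   ('c \<Rightarrow>\<^sub>L real) measure \<Rightarrow> real" where
  "j_fun F K \<mu> = F (calK K \<mu>) + tv_norm \<mu>"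

end

theory Submission
  imports Defs
begin

text \<open>
  Every \<open>\<mu> \<in> M\<^sup>+(\<B>)\<close> satisfies \<open>\<K> \<mu> = K (\<I> \<mu>)\<close> and \<open>\<G> (\<I> \<mu>) \<le> \<parallel>\<mu>\<parallel>\<close>, because \<open>\<I> \<mu> / \<parallel>\<mu>\<parallel>\<close> is a barycenter
  of points of the weak* compact convex set \<open>B\<close>; hence \<open>J (\<I> \<mu>) \<le> j \<mu>\<close>. Conversely, by the integral form of
  the Krein--Milman theorem, every \<open>u\<close> in the domain of \<open>\<G>\<close> is \<open>\<I> \<mu>\<close> for some \<open>\<mu>\<close> with \<open>\<parallel>\<mu>\<parallel> = \<G> u\<close>, and
  then \<open>J u = j \<mu>\<close>. This transfers minimisers in both directions.

  Existence for \<open>j\<close> is the direct method. By convexity, \<open>F\<close> is the supremum of its tangents, so \<open>j\<close> is a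
  supremum of weak* continuous functions. Its sublevel sets are closed subsets of norm balls of the cone
  \<open>M\<^sup>+(\<B>)\<close>, which are compact by Tychonoff's theorem and the Riesz representation theorem.

  Both barycenter statements are instances of one fact on affine systems over compact convex sets, proved by
  least squares instead of Hahn--Banach separation. Extreme points minimising a given \<open>p\<close> are found
  lexicographically along a dense sequence of \<open>\<C>\<close>.
\<close>

section \<open>The Riesz representation theorem on compact normal spaces\<close>

lemma continuous_map_compact_bounded:
  fixes f :: "'a \<Rightarrow> real"
  assumes "compact_space X" "continuous_map X euclideanreal f"
  obtains b where "0 < b" "\<And>x. x \<in> topspace X \<Longrightarrow> \<bar>f x\<bar> \<le> b"
proof -
  have "compact (f ` topspace X)"
    using image_compactin[OF _ assms(2), of "topspace X"] assms(1) by (simp add: compact_space_def)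
  then show ?thesis
    using that compact_imp_bounded by (metis bounded_pos imageI real_norm_def)
qed

lemma pos_radon_measuresD:
  assumes "\<mu> \<in> pos_radon_measures X"
  shows "finite_measure \<mu>" "space \<mu> = topspace X" "sets \<mu> = sets (borel_of_topology X)"
  using assms by (auto simp: pos_radon_measures_def)

lemma borel_measurable_continuous_map_radon:
  fixes f :: "'a \<Rightarrow> real"
  assumes \<mu>: "\<mu> \<in> pos_radon_measures X" and f: "continuous_map X euclideanreal f"
  shows "f \<in> borel_measurable \<mu>"
proof (rule borel_measurableI)
  fix S :: "real set" assume "open S"
  then have "openin X {x \<in> topspace X. f x \<in> S}"
    by (intro openin_continuous_map_preimage[OF f]) simp
  moreover have "{U. openin X U} \<subseteq> Pow (topspace X)"
    using openin_subset by auto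
  ultimately have "{x \<in> topspace X. f x \<in> S} \<in> sets (borel_of_topology X)"
    by (simp add: borel_of_topology_def sets_measure_of sigma_sets.Basic)
  moreover have "f -` S \<inter> space \<mu> = {x \<in> topspace X. f x \<in> S}"
    using pos_radon_measuresD(2)[OF \<mu>] by auto
  ultimately show "f -` S \<inter> space \<mu> \<in> sets \<mu>"
    using pos_radon_measuresD(3)[OF \<mu>] by simp
qed

lemma integrable_continuous_map_radon:
  fixes f :: "'a \<Rightarrow> real"
  assumes \<mu>: "\<mu> \<in> pos_radon_measures X" and X: "compact_space X"
    and f: "continuous_map X euclideanreal f"
  shows "integrable \<mu> f"
proof -
  obtain b where "\<And>x. x \<in> topspace X \<Longrightarrow> \<bar>f x\<bar> \<le> b"
    using continuous_map_compact_bounded[OF X f] by blast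
  then show ?thesis
    using borel_measurable_continuous_map_radon[OF \<mu> f] pos_radon_measuresD[OF \<mu>]
    by (intro finite_measure.integrable_const_bound[of _ _ b]) auto
qed

text \<open>Carries the hypotheses of the Riesz theorem. Normality supplies the Urysohn functions,
  compactness the finite subcovers.\<close>

locale positive_functional =
  fixes X :: "'a topology" and L :: "('a \<Rightarrow> real) \<Rightarrow> real"
  assumes compact: "compact_space X" and normal: "normal_space X"
    and add: "continuous_map X euclideanreal f \<Longrightarrow> continuous_map X euclideanreal g \<Longrightarrow>
      L (\<lambda>x. f x + g x) = L f + L g"
    and scale: "continuous_map X euclideanreal f \<Longrightarrow> L (\<lambda>x. c * f x) = c * L f"
    and nonneg: "continuous_map X euclideanreal f \<Longrightarrow> (\<And>x. x \<in> topspace X \<Longrightarrow> 0 \<le> f x) \<Longrightarrow> 0 \<le> L f"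
begin

lemma mono:
  assumes f: "continuous_map X euclideanreal f" and g: "continuous_map X euclideanreal g"
    and le: "\<And>x. x \<in> topspace X \<Longrightarrow> f x \<le> g x"
  shows "L f \<le> L g"
proof -
  have c: "continuous_map X euclideanreal (\<lambda>x. g x - f x)"
    using f g by (intro continuous_intros)
  have "L g = L (\<lambda>x. f x + (g x - f x))" by simp
  also have "\<dots> = L f + L (\<lambda>x. g x - f x)" using add[OF f c] .
  finally show ?thesis using nonneg[OF c] le by simp
qed

lemma zero: "L (\<lambda>_. 0) = 0"
  using scale[of "\<lambda>_. 0" 0] by simp

lemma const: "L (\<lambda>_. c) = c * L (\<lambda>_. 1)"
  using scale[of "\<lambda>_. 1" c] by simp

lemma unit_nonneg: "0 \<le> L (\<lambda>_. 1)"
  by (rule nonneg) auto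

lemma sum:
  assumes "finite A" "\<And>i. i \<in> A \<Longrightarrow> continuous_map X euclideanreal (f i)"
  shows "L (\<lambda>x. \<Sum>i\<in>A. f i x) = (\<Sum>i\<in>A. L (f i))"
  using assms
proof (induction A rule: finite_induct)
  case empty
  then show ?case by (simp add: zero)
next
  case (insert a A)
  then show ?case
    by (simp add: add continuous_map_sum)
qed

section \<open>Content of open sets and its subadditivity\<close>

definition test_functions :: "'a set \<Rightarrow> ('a \<Rightarrow> real) set" where
  "test_functions U = {f. continuous_map X euclideanreal f \<and>
     (\<forall>x\<in>topspace X. 0 \<le> f x \<and> f x \<le> 1) \<and> (\<forall>x\<in>topspace X - U. f x = 0)}"

definition content :: "'a set \<Rightarrow> ennreal" where
  "content U = (SUP f\<in>test_functions U. ennreal (L f))"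

definition outer :: "'a set \<Rightarrow> ennreal" where
  "outer A = (INF U\<in>{U. openin X U \<and> A \<subseteq> U}. content U)"

lemma test_functions_mono: "U \<subseteq> V \<Longrightarrow> test_functions U \<subseteq> test_functions V"
  by (auto simp: test_functions_def)

lemma content_mono: "U \<subseteq> V \<Longrightarrow> content U \<le> content V"
  unfolding content_def by (rule SUP_subset_mono[OF test_functions_mono]) auto

lemma content_upper: "f \<in> test_functions U \<Longrightarrow> ennreal (L f) \<le> content U"
  unfolding content_def by (rule SUP_upper)

lemma test_functions_nonneg: "f \<in> test_functions U \<Longrightarrow> 0 \<le> L f"
  by (rule nonneg) (auto simp: test_functions_def)

lemma content_empty: "content {} = 0"
proof -
  have "ennreal (L f) \<le> 0" if f: "f \<in> test_functions {}" for f
    using mono[of f "\<lambda>_. 0"] f zero by (auto simp: test_functions_def ennreal_neg)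
  then have "content {} \<le> 0"
    unfolding content_def by (rule SUP_least)
  then show ?thesis by simp
qed

lemma content_space: "content (topspace X) = ennreal (L (\<lambda>_. 1))"
proof (rule antisym)
  show "content (topspace X) \<le> ennreal (L (\<lambda>_. 1))"
    unfolding content_def
    by (rule SUP_least) (auto simp: test_functions_def intro!: ennreal_leI mono)
  show "ennreal (L (\<lambda>_. 1)) \<le> content (topspace X)"
    by (rule content_upper) (auto simp: test_functions_def)
qed

text \<open>Test functions need only vanish off \<open>U\<close>. Subtracting \<open>e\<close> and
  truncating leaves a function that vanishes off the closed set where \<open>e \<le> f\<close>, so
  it may be tested on any \<open>V\<close> covering the points with \<open>f x > e\<close>.\<close>

lemma cutoff_test_functions:
  assumes f: "f \<in> test_functions U" and e: "0 < e" and V: "\<And>x. x \<in> topspace X - V \<Longrightarrow> f x \<le> e"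
  shows "(\<lambda>x. max (f x - e) 0) \<in> test_functions V"
proof -
  have "continuous_map X euclideanreal (\<lambda>x. max (f x - e) 0)"
    using f by (intro continuous_map_real_max continuous_intros) (auto simp: test_functions_def)
  then show ?thesis
    using f e V by (auto simp: test_functions_def max_def)
qed

lemma cutoff_close:
  assumes f: "f \<in> test_functions U" and e: "0 < e"
  shows "L f \<le> L (\<lambda>x. max (f x - e) 0) + e * L (\<lambda>_. 1)"
proof -
  have cf: "continuous_map X euclideanreal f"
    using f by (simp add: test_functions_def)
  have cc: "continuous_map X euclideanreal (\<lambda>x. max (f x - e) 0)"
    by (intro continuous_map_real_max continuous_intros cf)
  have "L f \<le> L (\<lambda>x. max (f x - e) 0 + e)"
    by (rule mono) (auto intro: cf cc continuous_intros)
  also have "\<dots> = L (\<lambda>x. max (f x - e) 0) + e * L (\<lambda>_. 1)"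
    using add[OF cc, of "\<lambda>_. e"] const[of e] by simp
  finally show ?thesis .
qed

text \<open>The loss caused by a cutoff is at most \<open>e\<close> times the total mass, hence
  \<open>e\<close> depends on \<open>d\<close> alone and works for all test functions at
  once.\<close>

lemma small_cutoff:
  assumes "0 < d"
  obtains e where "0 < e" "\<And>f U. f \<in> test_functions U \<Longrightarrow> L f \<le> L (\<lambda>x. max (f x - e) 0) + d"
proof
  \<comment> \<open>The \<open>+ 1\<close> keeps the quotient positive when the total mass is
    zero.\<close>
  let ?e = "d / (L (\<lambda>_. 1) + 1)"
  show e: "0 < ?e" using assms unit_nonneg by simp
  have "?e * L (\<lambda>_. 1) \<le> d"
    using assms unit_nonneg by (simp add: field_simps)
  then show "L f \<le> L (\<lambda>x. max (f x - ?e) 0) + d" if "f \<in> test_functions U" for f U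
    using cutoff_close[OF that e] by linarith
qed

lemma closedin_superlevel:
  assumes "f \<in> test_functions U"
  shows "closedin X {x \<in> topspace X. e \<le> f x}"
proof -
  have "closedin X {x \<in> topspace X. f x \<in> {e..}}"
    by (rule closedin_continuous_map_preimage) (use assms in \<open>auto simp: test_functions_def\<close>)
  then show ?thesis by simp
qed

text \<open>Partition of unity: a Urysohn function \<open>g\<close> vanishes off \<open>U\<close>
  and equals 1 on the part of the superlevel set of \<open>f\<close> lying outside \<open>V\<close>.
  The cutoff of \<open>f\<close> then splits into its products with \<open>g\<close> and
  \<open>1 - g\<close>, which are test functions for \<open>U\<close> and \<open>V\<close>.\<close>

lemma content_Un:
  assumes U: "openin X U" and V: "openin X V"
  shows "content (U \<union> V) \<le> content U + content V"
  unfolding content_def[of "U \<union> V"]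
proof (rule SUP_least, rule ennreal_le_epsilon)
  fix f and d :: real
  assume f: "f \<in> test_functions (U \<union> V)" and d: "0 < d"
  obtain e where e: "0 < e" and eL: "L f \<le> L (\<lambda>x. max (f x - e) 0) + d"
    using small_cutoff[OF d] f by metis
  let ?h = "\<lambda>x. max (f x - e) 0"
  let ?C = "{x \<in> topspace X. e \<le> f x} - V"
  have C: "closedin X ?C"
    using closedin_superlevel[OF f] V by (rule closedin_diff)
  have D: "closedin X (topspace X - U)" using U by blast
  have "disjnt ?C (topspace X - U)"
    using f e by (auto simp: disjnt_def test_functions_def)
  then obtain g where g: "continuous_map X (top_of_set {0..1::real}) g"
    and g1: "g ` (topspace X - U) \<subseteq> {0}" and g2: "g ` ?C \<subseteq> {1}"
    using Urysohn_lemma[OF normal D C, of 0 1] by (auto simp: disjnt_sym)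
  have gc: "continuous_map X euclideanreal g" and g01: "\<And>x. x \<in> topspace X \<Longrightarrow> 0 \<le> g x \<and> g x \<le> 1"
    using g by (auto simp: continuous_map_in_subtopology)
  have h: "?h \<in> test_functions UNIV"
    by (rule cutoff_test_functions[OF f e]) auto
  then have hc: "continuous_map X euclideanreal ?h" and h01: "\<And>x. x \<in> topspace X \<Longrightarrow> 0 \<le> ?h x \<and> ?h x \<le> 1"
    by (auto simp: test_functions_def)
  have a: "(\<lambda>x. ?h x * g x) \<in> test_functions U"
    unfolding test_functions_def
    using h01 g01 g1 by (auto intro!: continuous_map_real_mult hc gc mult_le_one mult_nonneg_nonneg)
  have b: "(\<lambda>x. ?h x * (1 - g x)) \<in> test_functions V"
    unfolding test_functions_def
  proof (intro CollectI conjI ballI)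
    show "continuous_map X euclideanreal (\<lambda>x. ?h x * (1 - g x))"
      by (intro continuous_map_real_mult hc continuous_intros gc) 
  next
    fix x assume x: "x \<in> topspace X - V"
    show "?h x * (1 - g x) = 0"
    proof (cases "e \<le> f x")
      case True
      then have "g x = 1" using x g2 by auto
      then show ?thesis by simp
    qed auto
  qed (use h01 g01 in \<open>auto intro!: mult_le_one mult_nonneg_nonneg\<close>)
  have "L ?h = L (\<lambda>x. ?h x * g x + ?h x * (1 - g x))"
    by (simp add: algebra_simps)
  also have "\<dots> = L (\<lambda>x. ?h x * g x) + L (\<lambda>x. ?h x * (1 - g x))"
    using a b by (intro add) (auto simp: test_functions_def)
  finally have "L f \<le> L (\<lambda>x. ?h x * g x) + L (\<lambda>x. ?h x * (1 - g x)) + d"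
    using eL by simp
  then have "ennreal (L f) \<le> ennreal (L (\<lambda>x. ?h x * g x) + L (\<lambda>x. ?h x * (1 - g x)) + d)"
    by (rule ennreal_leI)
  also have "\<dots> = ennreal (L (\<lambda>x. ?h x * g x)) + ennreal (L (\<lambda>x. ?h x * (1 - g x))) + ennreal d"
    using test_functions_nonneg[OF a] test_functions_nonneg[OF b] d by (simp add: ennreal_plus)
  also have "\<dots> \<le> content U + content V + ennreal d"
    by (intro add_mono content_upper a b order_refl)
  finally show "ennreal (L f) \<le> content U + content V + ennreal d" .
qed

lemma content_finite_UN:
  assumes "\<And>i. openin X (U i)"
  shows "content (\<Union>i<(n::nat). U i) \<le> (\<Sum>i<n. content (U i))"
proof (induction n)
  case 0
  then show ?case by (simp add: content_empty)
next
  case (Suc n)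
  have "content (\<Union>i<Suc n. U i) \<le> content (\<Union>i<n. U i) + content (U n)"
    unfolding lessThan_Suc UN_insert Un_commute[of "U n"]
    by (intro content_Un openin_Union) (use assms in auto)
  also have "\<dots> \<le> (\<Sum>i<n. content (U i)) + content (U n)"
    by (rule add_right_mono[OF Suc])
  finally show ?case by simp
qed

text \<open>The superlevel set carrying a cutoff test function is compact, so finitely many of the
  \<open>U i\<close> cover it and finite subadditivity applies.\<close>

lemma content_UN:
  assumes U: "\<And>i::nat. openin X (U i)"
  shows "content (\<Union>i. U i) \<le> (\<Sum>i. content (U i))"
  unfolding content_def[of "\<Union>i. U i"]
proof (rule SUP_least, rule ennreal_le_epsilon)
  fix f and d :: real
  assume f: "f \<in> test_functions (\<Union>i. U i)" and d: "0 < d"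
  obtain e where e: "0 < e" and eL: "L f \<le> L (\<lambda>x. max (f x - e) 0) + d"
    using small_cutoff[OF d] f by metis
  let ?h = "\<lambda>x. max (f x - e) 0"
  let ?C = "{x \<in> topspace X. e \<le> f x}"
  have C: "compactin X ?C"
    using closedin_superlevel[OF f] compact by (simp add: closedin_compact_space)
  have "?C \<subseteq> \<Union>(range U)"
  proof
    fix x assume x: "x \<in> ?C"
    show "x \<in> \<Union>(range U)"
    proof (rule ccontr)
      assume "x \<notin> \<Union>(range U)"
      then have "f x = 0" using f x by (auto simp: test_functions_def)
      then show False using x e by simp
    qed
  qed
  then obtain \<F> where "finite \<F>" "\<F> \<subseteq> range U" and cov: "?C \<subseteq> \<Union>\<F>"
    using C U unfolding compactin_def by (metis (no_types, lifting) rangeE)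
  then obtain I where I: "finite I" "\<F> = U ` I"
    by (metis finite_subset_image)
  then obtain n where n: "I \<subseteq> {..<n}"
    by (meson finite_nat_iff_bounded)
  have "?h \<in> test_functions (\<Union>i<n. U i)"
  proof (rule cutoff_test_functions[OF f e])
    fix x assume "x \<in> topspace X - (\<Union>i<n. U i)"
    then have "x \<in> topspace X" "x \<notin> ?C" using cov I n by auto
    then show "f x \<le> e" by simp
  qed
  then have "ennreal (L ?h) \<le> (\<Sum>i<n. content (U i))"
    using content_upper content_finite_UN[OF U] by (meson order_trans)
  also have "\<dots> \<le> (\<Sum>i. content (U i))"
    by (rule sum_le_suminf) auto
  finally have h: "ennreal (L ?h) \<le> (\<Sum>i. content (U i))" .
  have "0 \<le> L ?h"
    by (rule test_functions_nonneg[OF cutoff_test_functions[OF f e, of UNIV]]) auto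
  have "ennreal (L f) \<le> ennreal (L ?h + d)"
    using eL by (rule ennreal_leI)
  also have "\<dots> = ennreal (L ?h) + ennreal d"
    using \<open>0 \<le> L ?h\<close> d by simp
  finally show "ennreal (L f) \<le> (\<Sum>i. content (U i)) + ennreal d"
    using h by (meson add_right_mono order_trans)
qed

section \<open>The induced outer measure and Caratheodory measurability of open sets\<close>

lemma outer_open: "openin X U \<Longrightarrow> outer U = content U"
  unfolding outer_def
  by (rule antisym) (auto intro!: INF_lower INF_greatest content_mono)

lemma outer_mono: "A \<subseteq> B \<Longrightarrow> outer A \<le> outer B"
  unfolding outer_def by (rule INF_superset_mono) auto

lemma outer_le_space: "A \<subseteq> topspace X \<Longrightarrow> outer A \<le> ennreal (L (\<lambda>_. 1))"
  using outer_mono[of A "topspace X"] by (simp add: outer_open content_space)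

lemma outer_approx:
  assumes A: "A \<subseteq> topspace X" and e: "0 < e"
  obtains U where "openin X U" "A \<subseteq> U" "content U \<le> outer A + ennreal e"
proof -
  have fin: "outer A < \<infinity>"
    using outer_le_space[OF A] by (simp add: order_le_less_trans)
  have "outer A < outer A + ennreal e"
    using fin e by (simp add: ennreal_add_left_cancel_less)
  then show ?thesis
    unfolding outer_def[of A] INF_less_iff
    using that by (metis (no_types, lifting) less_imp_le mem_Collect_eq outer_def)
qed

lemma outer_UN:
  assumes A: "\<And>i::nat. A i \<subseteq> topspace X"
  shows "outer (\<Union>i. A i) \<le> (\<Sum>i. outer (A i))"
proof (rule ennreal_le_epsilon)
  fix e :: real assume e: "0 < e"
  have "\<forall>i. \<exists>U. openin X U \<and> A i \<subseteq> U \<and> content U \<le> outer (A i) + ennreal (e * (1/2)^Suc i)"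
    using outer_approx[OF A] e by (metis half_gt_zero_iff mult_pos_pos zero_less_one zero_less_power)
  then obtain U where U: "\<And>i. openin X (U i)" "\<And>i. A i \<subseteq> U i"
    and UA: "\<And>i. content (U i) \<le> outer (A i) + ennreal (e * (1/2)^Suc i)"
    by metis
  have "outer (\<Union>i. A i) \<le> outer (\<Union>i. U i)"
    using U by (intro outer_mono) blast
  also have "\<dots> = content (\<Union>i. U i)"
    using U by (intro outer_open) blast
  also have "\<dots> \<le> (\<Sum>i. content (U i))"
    using U(1) by (rule content_UN)
  also have "\<dots> \<le> (\<Sum>i. outer (A i) + ennreal (e * (1/2)^Suc i))"
    using UA by (intro suminf_le) auto
  also have "\<dots> = (\<Sum>i. outer (A i)) + (\<Sum>i. ennreal (e * (1/2)^Suc i))"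
    by (rule suminf_add[symmetric]) auto
  also have "(\<Sum>i. ennreal (e * (1/2)^Suc i)) = ennreal (e * 1)"
    using e by (intro suminf_ennreal_eq sums_mult power_half_series) auto
  finally show "outer (\<Union>i. A i) \<le> (\<Sum>i. outer (A i)) + ennreal e" by simp
qed

lemma outer_empty: "outer {} = 0"
  by (simp add: outer_open content_empty)

lemma outer_measure_space_outer: "outer_measure_space (Pow (topspace X)) outer"
  unfolding outer_measure_space_def positive_def increasing_def countably_subadditive_def
  by (auto simp: outer_empty intro!: outer_mono outer_UN)

text \<open>Disjointness of supports: a test function on \<open>A \<inter> U\<close> lives, up to a cutoff, on a closed set
  whose complement in \<open>A\<close> is an open neighbourhood of \<open>A - U\<close>.\<close>

lemma content_split:
  assumes A: "openin X A" and U: "openin X U"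
  shows "content (A \<inter> U) + outer (A - U) \<le> content A"
proof (rule ennreal_le_epsilon)
  fix d :: real assume d: "0 < d"
  have d2: "0 < d / 2" using d by simp
  have "ennreal (L f) + outer (A - U) \<le> content A + ennreal d" if f: "f \<in> test_functions (A \<inter> U)" for f
  proof -
    obtain e where e: "0 < e" and eL: "L f \<le> L (\<lambda>x. max (f x - e) 0) + d"
      using small_cutoff[OF d] f by metis
    let ?h = "\<lambda>x. max (f x - e) 0"
    let ?C = "{x \<in> topspace X. e \<le> f x}"
    have h: "?h \<in> test_functions (A \<inter> U)"
      using f e by (intro cutoff_test_functions[OF f e]) (auto simp: test_functions_def)
    have O: "openin X (A - ?C)"
      using A closedin_superlevel[OF f] by (rule openin_diff)
    have "A - U \<subseteq> A - ?C"
      using f e by (auto simp: test_functions_def)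
    then have "outer (A - U) \<le> content (A - ?C)"
      using outer_mono[of "A - U" "A - ?C"] outer_open[OF O] by simp
    have "ennreal (L ?h) + content (A - ?C) \<le> content A"
      unfolding content_def[of "A - ?C"]
    proof (subst ennreal_SUP_add_right)
      have "(\<lambda>_. 0) \<in> test_functions (A - ?C)" by (auto simp: test_functions_def)
      then show "test_functions (A - ?C) \<noteq> {}" by blast
      show "(SUP g\<in>test_functions (A - ?C). ennreal (L ?h) + ennreal (L g)) \<le> content A"
      proof (rule SUP_least)
        fix g assume g: "g \<in> test_functions (A - ?C)"
        \<comment> \<open>The two summands are never nonzero at the same point, so their sum still
          takes values in \<open>[0, 1]\<close>.\<close>
        have z: "g x = 0 \<or> ?h x = 0" if "x \<in> topspace X" for x
          using g that by (cases "e \<le> f x") (auto simp: test_functions_def)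
        have "(\<lambda>x. ?h x + g x) \<in> test_functions A"
          unfolding test_functions_def
        proof (intro CollectI conjI ballI)
          show "continuous_map X euclideanreal (\<lambda>x. ?h x + g x)"
            using g h by (auto simp: test_functions_def intro: continuous_intros)
          fix x assume x: "x \<in> topspace X"
          have "0 \<le> g x" "g x \<le> 1" "0 \<le> ?h x" "?h x \<le> 1"
            using g h x by (auto simp: test_functions_def)
          then show "0 \<le> ?h x + g x" "?h x + g x \<le> 1"
            using z[OF x] by linarith+
        next
          fix x assume "x \<in> topspace X - A"
          then have "g x = 0" "?h x = 0" using g h unfolding test_functions_def by blast+
          then show "?h x + g x = 0" by linarith
        qed
        moreover have "L (\<lambda>x. ?h x + g x) = L ?h + L g"
          using g h by (intro add) (auto simp: test_functions_def)
        ultimately show "ennreal (L ?h) + ennreal (L g) \<le> content A"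
          using content_upper[of "\<lambda>x. ?h x + g x" A] test_functions_nonneg[OF g] test_functions_nonneg[OF h]
          by simp
      qed
    qed
    then have *: "ennreal (L ?h) + outer (A - U) \<le> content A"
      using \<open>outer (A - U) \<le> content (A - ?C)\<close> by (meson add_left_mono order_trans)
    have "ennreal (L f) \<le> ennreal (L ?h) + ennreal d"
      using ennreal_leI[OF eL] test_functions_nonneg[OF h] d by simp
    then have "ennreal (L f) + outer (A - U) \<le> ennreal (L ?h) + ennreal d + outer (A - U)"
      by (rule add_right_mono)
    also have "\<dots> = (ennreal (L ?h) + outer (A - U)) + ennreal d"
      by (simp add: ac_simps)
    also have "\<dots> \<le> content A + ennreal d"
      using * by (rule add_right_mono)
    finally show ?thesis .
  qed
  moreover have "(\<lambda>_. 0) \<in> test_functions (A \<inter> U)" by (auto simp: test_functions_def)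
  ultimately show "content (A \<inter> U) + outer (A - U) \<le> content A + ennreal d"
    unfolding content_def[of "A \<inter> U"]
    by (subst ennreal_SUP_add_left[symmetric]) (auto intro!: SUP_least)
qed

text \<open>Splitting an arbitrary \<open>A\<close> along \<open>U\<close> reduces to splitting the
  open supersets \<open>V\<close> of \<open>A\<close>, where \<open>content_split\<close> applies;
  the infimum over \<open>V\<close> gives the nontrivial inequality.\<close>

lemma openin_lambda_system:
  assumes U: "openin X U"
  shows "U \<in> lambda_system (topspace X) (Pow (topspace X)) outer"
proof -
  interpret sigma_algebra "topspace X" "Pow (topspace X)" by (rule sigma_algebra_Pow)
  have sub: "subadditive (Pow (topspace X)) outer"
    using outer_measure_space_outer unfolding outer_measure_space_def
    by (intro countably_subadditive_subadditive) auto
  have "outer (A \<inter> U) + outer (A - U) = outer A" if A: "A \<subseteq> topspace X" for A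
  proof (rule antisym)
    show "outer (A \<inter> U) + outer (A - U) \<le> outer A"
      unfolding outer_def[of A]
    proof (rule INF_greatest)
      fix V assume "V \<in> {V. openin X V \<and> A \<subseteq> V}"
      then have V: "openin X V" "A \<subseteq> V" by auto
      have "outer (A \<inter> U) + outer (A - U) \<le> outer (V \<inter> U) + outer (V - U)"
        using V by (intro add_mono outer_mono) auto
      also have "outer (V \<inter> U) = content (V \<inter> U)"
        using U V by (intro outer_open openin_Int)
      also have "content (V \<inter> U) + outer (V - U) \<le> content V"
        using V(1) U by (rule content_split)
      finally show "outer (A \<inter> U) + outer (A - U) \<le> content V" .
    qed
    have "outer ((A \<inter> U) \<union> (A - U)) \<le> outer (A \<inter> U) + outer (A - U)"
      by (rule subadditiveD[OF sub]) (use A in auto)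
    moreover have "(A \<inter> U) \<union> (A - U) = A" by blast
    ultimately show "outer A \<le> outer (A \<inter> U) + outer (A - U)" by simp
  qed
  then show ?thesis
    using openin_subset[OF U] by (auto simp: lambda_system_eq)
qed

section \<open>The representing Borel measure and its regularity\<close>

definition riesz_measure :: "'a measure" where
  "riesz_measure = measure_of (topspace X) {U. openin X U} outer"

lemma openin_Pow: "{U. openin X U} \<subseteq> Pow (topspace X)"
  using openin_subset by auto

lemma space_riesz_measure [simp]: "space riesz_measure = topspace X"
  by (simp add: riesz_measure_def space_measure_of[OF openin_Pow])

lemma sets_riesz_measure: "sets riesz_measure = sets (borel_of_topology X)"
  by (simp add: riesz_measure_def borel_of_topology_def sets_measure_of[OF openin_Pow])

lemma openin_sets_riesz_measure: "openin X U \<Longrightarrow> U \<in> sets riesz_measure"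
  by (simp add: riesz_measure_def sets_measure_of[OF openin_Pow] sigma_sets.Basic)

text \<open>Caratheodory's theorem makes \<open>outer\<close> a measure on the
  \<open>lambda_system\<close>, which contains the open sets and therefore every Borel set.\<close>

lemma emeasure_riesz_measure:
  assumes "A \<in> sets riesz_measure"
  shows "emeasure riesz_measure A = outer A"
proof -
  interpret P: sigma_algebra "topspace X" "Pow (topspace X)" by (rule sigma_algebra_Pow)
  let ?S = "lambda_system (topspace X) (Pow (topspace X)) outer"
  have ms: "measure_space (topspace X) ?S outer"
    by (rule P.caratheodory_lemma[OF outer_measure_space_outer])
  then interpret S: sigma_algebra "topspace X" ?S
    by (simp add: measure_space_def)
  have sub: "sigma_sets (topspace X) {U. openin X U} \<subseteq> ?S"
    by (rule S.sigma_sets_subset) (use openin_lambda_system in auto)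
  show ?thesis
  proof (rule emeasure_measure_of[OF riesz_measure_def openin_Pow])
    have "sets riesz_measure \<subseteq> ?S"
      using sub by (simp add: riesz_measure_def sets_measure_of[OF openin_Pow])
    then show "positive (sets riesz_measure) outer" "countably_additive (sets riesz_measure) outer"
      using ms unfolding measure_space_def positive_def countably_additive_def by auto
  qed (rule assms)
qed

lemma emeasure_riesz_measure_space: "emeasure riesz_measure (topspace X) = ennreal (L (\<lambda>_. 1))"
  by (simp add: emeasure_riesz_measure openin_sets_riesz_measure outer_open content_space)

sublocale riesz: finite_measure riesz_measure
  by standard (simp add: emeasure_riesz_measure_space)

lemma measure_riesz_measure_space: "measure riesz_measure (topspace X) = L (\<lambda>_. 1)"
  by (simp add: measure_def emeasure_riesz_measure_space unit_nonneg)

text \<open>Outer regularity is built into \<open>outer\<close>. Applied to the complement of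
  \<open>A\<close> it gives an open \<open>U\<close>, whose complement is a compact subset of
  \<open>A\<close>; finiteness of the mass turns the estimate for \<open>U\<close> into one for that
  compact set.\<close>

lemma riesz_measure_radon: "riesz_measure \<in> pos_radon_measures X"
proof -
  have "emeasure riesz_measure A = (SUP C \<in> {C. C \<subseteq> A \<and> compactin X C}. emeasure riesz_measure C)"
    if A: "A \<in> sets riesz_measure" for A
  proof (rule antisym)
    show "(SUP C \<in> {C. C \<subseteq> A \<and> compactin X C}. emeasure riesz_measure C) \<le> emeasure riesz_measure A"
      by (rule SUP_least) (use A in \<open>auto intro: emeasure_mono\<close>)
    have AX: "A \<subseteq> topspace X" using sets.sets_into_space[OF A] by simp
    show "emeasure riesz_measure A \<le> (SUP C \<in> {C. C \<subseteq> A \<and> compactin X C}. emeasure riesz_measure C)"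
    proof (rule ennreal_le_epsilon)
      fix e :: real assume e: "0 < e"
      have Ac: "topspace X - A \<in> sets riesz_measure"
        using sets.compl_sets[OF A] by simp
      obtain U where U: "openin X U" "topspace X - A \<subseteq> U"
        and Ue: "content U \<le> outer (topspace X - A) + ennreal e"
        using outer_approx[of "topspace X - A" e] e by blast
      let ?C = "topspace X - U"
      have C: "?C \<subseteq> A" "compactin X ?C"
        using U compact by (auto intro: closedin_compact_space)
      have Us: "U \<in> sets riesz_measure" using U openin_sets_riesz_measure by blast
      have "measure riesz_measure U \<le> measure riesz_measure (topspace X - A) + e"
      proof -
        have "emeasure riesz_measure U \<le> emeasure riesz_measure (topspace X - A) + ennreal e"
          using Ue by (simp add: emeasure_riesz_measure Us Ac outer_open U(1))
        then have "ennreal (measure riesz_measure U) \<le> ennreal (measure riesz_measure (topspace X - A) + e)"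
          using e by (simp add: riesz.emeasure_eq_measure)
        then show ?thesis
            using e by (subst (asm) ennreal_le_iff) auto
      qed
      moreover have "measure riesz_measure ?C = measure riesz_measure (topspace X) - measure riesz_measure U"
        using riesz.finite_measure_compl[OF Us] by simp
      moreover have "measure riesz_measure (topspace X - A) = measure riesz_measure (topspace X) - measure riesz_measure A"
        using riesz.finite_measure_compl[OF A] by simp
      ultimately have "measure riesz_measure A \<le> measure riesz_measure ?C + e"
        by simp
      then have "emeasure riesz_measure A \<le> emeasure riesz_measure ?C + ennreal e"
        using e by (simp add: riesz.emeasure_eq_measure flip: ennreal_plus)
      also have "\<dots> \<le> (SUP C \<in> {C. C \<subseteq> A \<and> compactin X C}. emeasure riesz_measure C) + ennreal e"
        using C by (intro add_right_mono SUP_upper) auto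
      finally show "emeasure riesz_measure A \<le>
          (SUP C \<in> {C. C \<subseteq> A \<and> compactin X C}. emeasure riesz_measure C) + ennreal e" .
    qed
  qed
  then show ?thesis
    unfolding pos_radon_measures_def
    using sets_riesz_measure riesz.finite_measure_axioms by auto
qed

section \<open>Integrals of continuous functions against the representing measure\<close>

lemma integrable_riesz_measure:
  "continuous_map X euclideanreal f \<Longrightarrow> integrable riesz_measure f"
  by (rule integrable_continuous_map_radon[OF riesz_measure_radon compact])

text \<open>Layer-cake argument: \<open>f\<close> is cut into \<open>n\<close> horizontal slices of height \<open>1/n\<close>.\<close>

lemma le_integral_unit:
  assumes f: "continuous_map X euclideanreal f"
    and f01: "\<And>x. x \<in> topspace X \<Longrightarrow> 0 \<le> f x \<and> f x \<le> 1"
  shows "L f \<le> (\<integral>x. f x \<partial>riesz_measure)"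
proof -
  have approx: "L f \<le> (\<integral>x. f x \<partial>riesz_measure) + L (\<lambda>_. 1) / real n" if n: "0 < n" for n :: nat
  proof -
    define s where "s k x = min (max (f x - real k / n) 0) (1 / n)" for k x
    define U where "U k = {x \<in> topspace X. f x \<in> {real k / n <..}}" for k
    have sc: "continuous_map X euclideanreal (s k)" for k
      unfolding s_def[abs_def] by (intro continuous_map_real_min continuous_map_real_max continuous_intros f)
    have U: "openin X (U k)" for k
      unfolding U_def by (rule openin_continuous_map_preimage[OF f]) simp
    have Us: "U k \<in> sets riesz_measure" for k
      using U by (rule openin_sets_riesz_measure)
    \<comment> \<open>Telescoping identity: the part of \<open>y\<close> below \<open>t\<close> plus
      the slice of height \<open>h\<close> above \<open>t\<close> is the part below
      \<open>h + t\<close>.\<close>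
    have slice: "min y t + min (max (y - t) 0) h = min y (h + t)" if "0 \<le> h" for y t h :: real
      using that by (auto simp: min_def max_def)
    have "(\<Sum>k<m. s k x) = min (f x) (real m / n)" if "x \<in> topspace X" for m x
      using f01[OF that] n by (induction m) (auto simp: s_def add_divide_distrib slice)
    then have s_sum: "(\<Sum>k<n. s k x) = f x" if "x \<in> topspace X" for x
      using f01[OF that] n that by simp
    have UX: "U k \<inter> topspace X = U k" for k
      by (auto simp: U_def)
    \<comment> \<open>Rescaled by \<open>n\<close>, a slice is a test function for
      \<open>U k\<close>, so its functional value is controlled by the content.\<close>
    have L_s: "L (s k) \<le> measure riesz_measure (U k) / n" for k
    proof -
      have "continuous_map X euclideanreal (\<lambda>x. real n * s k x)"
        by (intro continuous_map_real_mult sc) auto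
      moreover have "0 \<le> s k x" "s k x \<le> 1 / n" for x
        using n by (auto simp: s_def)
      then have "0 \<le> real n * s k x \<and> real n * s k x \<le> 1" for x
        using n by (simp add: field_simps)
      moreover have "s k x = 0" if "x \<in> topspace X - U k" for x
        using that n by (auto simp: s_def U_def)
      ultimately have "(\<lambda>x. real n * s k x) \<in> test_functions (U k)"
        by (auto simp: test_functions_def)
      then have "ennreal (L (\<lambda>x. real n * s k x)) \<le> emeasure riesz_measure (U k)"
        using content_upper by (simp add: emeasure_riesz_measure Us outer_open U)
      then have "L (\<lambda>x. real n * s k x) \<le> measure riesz_measure (U k)"
        by (simp add: riesz.emeasure_eq_measure)
      then show ?thesis
        using n scale[OF sc] by (simp add: field_simps)
    qed
    \<comment> \<open>The bound \<open>real m / n\<close> drives the induction: step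
      \<open>m\<close> contributes only where \<open>f x > real m / n\<close>, and there the
      enlarged sum stays below \<open>f x + 1 / n\<close>.\<close>
    have steps: "(\<Sum>k<m. indicator (U k) x / n) \<le> min (real m / n) (f x + 1 / n)"
      if "x \<in> topspace X" for m x
      using f01[OF that] n that
      by (induction m) (auto simp: U_def indicator_def add_divide_distrib)
    have "L f \<le> L (\<lambda>x. \<Sum>k<n. s k x)"
      by (rule mono) (auto intro!: f continuous_map_sum sc simp: s_sum)
    also have "\<dots> = (\<Sum>k<n. L (s k))"
      by (rule sum) (auto intro: sc)
    also have "\<dots> \<le> (\<Sum>k<n. measure riesz_measure (U k) / n)"
      by (rule sum_mono[OF L_s])
    also have "\<dots> = (\<integral>x. (\<Sum>k<n. indicator (U k) x / n) \<partial>riesz_measure)"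
      using Us UX by (simp add: riesz.emeasure_eq_measure)
    also have "\<dots> \<le> (\<integral>x. f x + 1 / n \<partial>riesz_measure)"
    proof (rule integral_mono)
      show "integrable riesz_measure (\<lambda>x. \<Sum>k<n. indicator (U k) x / n :: real)"
        by (intro Bochner_Integration.integrable_sum) (use Us in \<open>simp add: riesz.emeasure_eq_measure\<close>)
      show "integrable riesz_measure (\<lambda>x. f x + 1 / n)"
        by (intro Bochner_Integration.integrable_add integrable_riesz_measure f) simp
    qed (use steps[of _ n] in auto)
    also have "\<dots> = (\<integral>x. f x \<partial>riesz_measure) + L (\<lambda>_. 1) / n"
      using integrable_riesz_measure[OF f] by (simp add: measure_riesz_measure_space)
    finally show ?thesis .
  qed
  have "(\<lambda>n. (\<integral>x. f x \<partial>riesz_measure) + L (\<lambda>_. 1) / real n) \<longlonglongrightarrow> (\<integral>x. f x \<partial>riesz_measure) + 0"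
    by (intro tendsto_intros lim_const_over_n)
  then show ?thesis
    using approx by (intro LIMSEQ_le_const[of _ _ "L f"]) (auto intro!: exI[of _ 1])
qed

text \<open>An affine change of scale brings the bounded \<open>f\<close> into
  \<open>[0, 1]\<close>; it can be undone because \<open>L\<close> and the integral agree on
  constants.\<close>

lemma le_integral:
  assumes f: "continuous_map X euclideanreal f"
  shows "L f \<le> (\<integral>x. f x \<partial>riesz_measure)"
proof -
  obtain b where b: "0 < b" "\<And>x. x \<in> topspace X \<Longrightarrow> \<bar>f x\<bar> \<le> b"
    using continuous_map_compact_bounded[OF compact f] by blast
  let ?g = "\<lambda>x. 1 / (2 * b) * (f x + b)"
  have fb: "continuous_map X euclideanreal (\<lambda>x. f x + b)"
    using f by (intro continuous_intros) auto
  have "L ?g \<le> (\<integral>x. ?g x \<partial>riesz_measure)"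
  proof (rule le_integral_unit)
    show "continuous_map X euclideanreal ?g"
      using fb by (intro continuous_map_real_mult) auto
    show "0 \<le> ?g x \<and> ?g x \<le> 1" if "x \<in> topspace X" for x
      using b(1) b(2)[OF that] by (auto simp: field_simps)
  qed
  moreover have "L ?g = 1 / (2 * b) * (L f + b * L (\<lambda>_. 1))"
    unfolding scale[OF fb] using add[OF f, of "\<lambda>_. b"] const[of b] by simp
  moreover have "(\<integral>x. ?g x \<partial>riesz_measure) = 1 / (2 * b) * (\<integral>x. f x + b \<partial>riesz_measure)"
    by (rule integral_mult_right_zero)
  moreover have "(\<integral>x. f x + b \<partial>riesz_measure) = (\<integral>x. f x \<partial>riesz_measure) + b * L (\<lambda>_. 1)"
    using integrable_riesz_measure[OF f] by (simp add: measure_riesz_measure_space)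
  ultimately have "1 / (2 * b) * (L f + b * L (\<lambda>_. 1)) \<le>
      1 / (2 * b) * ((\<integral>x. f x \<partial>riesz_measure) + b * L (\<lambda>_. 1))"
    by (simp only:)
  then show ?thesis
    using b(1) by (simp add: divide_le_cancel)
qed

text \<open>The one-sided estimate for \<open>-f\<close> is the missing inequality for
  \<open>f\<close>.\<close>

theorem integral_riesz_measure:
  assumes f: "continuous_map X euclideanreal f"
  shows "(\<integral>x. f x \<partial>riesz_measure) = L f"
proof (rule antisym[OF _ le_integral[OF f]])
  have "- L f = L (\<lambda>x. - f x)"
    using scale[OF f, of "-1"] by simp
  also have "\<dots> \<le> (\<integral>x. - f x \<partial>riesz_measure)"
    using f by (intro le_integral continuous_map_minus)
  finally show "(\<integral>x. f x \<partial>riesz_measure) \<le> L f" by simp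
qed

end

section \<open>Weak* compactness of bounded sets of measures\<close>

text \<open>Open sets of the pullback are traces of preimages, so an open cover of \<open>S\<close>
  comes from an open cover of its image, and a finite subcover can be pulled back.\<close>

lemma compactin_pullback_topology:
  assumes S: "S \<subseteq> A" and c: "compactin T (f ` S)"
  shows "compactin (pullback_topology A f T) S"
  unfolding compactin_def
proof (intro conjI allI impI)
  show "S \<subseteq> topspace (pullback_topology A f T)"
    using S compactin_subset_topspace[OF c] by (auto simp: topspace_pullback_topology)
  fix \<U> assume \<U>: "(\<forall>U\<in>\<U>. openin (pullback_topology A f T) U) \<and> S \<subseteq> \<Union>\<U>"
  then have "\<forall>U\<in>\<U>. \<exists>V. openin T V \<and> U = f -` V \<inter> A"
    by (simp add: openin_pullback_topology)
  then obtain V where V: "\<And>U. U \<in> \<U> \<Longrightarrow> openin T (V U) \<and> U = f -` V U \<inter> A"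
    by metis
  have cover: "f ` S \<subseteq> \<Union>(V ` \<U>)"
  proof
    fix y assume "y \<in> f ` S"
    then obtain x U where "x \<in> S" "y = f x" "U \<in> \<U>" "x \<in> U"
      using \<U> by blast
    then show "y \<in> \<Union>(V ` \<U>)" using V by blast
  qed
  then obtain \<F> where "finite \<F>" "\<F> \<subseteq> V ` \<U>" "f ` S \<subseteq> \<Union>\<F>"
    using c V unfolding compactin_def by (metis (no_types, lifting) imageE)
  then obtain \<G> where \<G>: "finite \<G>" "\<G> \<subseteq> \<U>" "f ` S \<subseteq> \<Union>(V ` \<G>)"
    by (metis finite_subset_image)
  have "S \<subseteq> \<Union>\<G>"
  proof
    fix x assume x: "x \<in> S"
    then obtain U where "U \<in> \<G>" "f x \<in> V U" using \<G>(3) by blast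
    then have "x \<in> U" using V[of U] \<G>(2) x S by auto
    then show "x \<in> \<Union>\<G>" using \<open>U \<in> \<G>\<close> by blast
  qed
  then show "\<exists>\<F>. finite \<F> \<and> \<F> \<subseteq> \<U> \<and> S \<subseteq> \<Union>\<F>"
    using \<G> by blast
qed

text \<open>By additivity all partitions give the same sum, so the supremum is over a single
  value.\<close>

lemma tv_norm_finite_measure:
  assumes "finite_measure \<mu>"
  shows "tv_norm \<mu> = measure \<mu> (space \<mu>)"
proof -
  let ?P = "{P. finite P \<and> partition_on (space \<mu>) P \<and> P \<subseteq> sets \<mu>}"
  have sum: "(\<Sum>A\<in>P. \<bar>measure \<mu> A\<bar>) = measure \<mu> (space \<mu>)" if "P \<in> ?P" for P
  proof -
    have "measure \<mu> (\<Union>A\<in>P. A) = (\<Sum>A\<in>P. measure \<mu> A)"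
      by (rule finite_measure.finite_measure_finite_Union[OF assms])
        (use that in \<open>auto simp: partition_on_def disjoint_family_on_def disjnt_def pairwise_def\<close>)
    moreover have "(\<Union>A\<in>P. A) = space \<mu>"
      using that by (auto simp: partition_on_def)
    ultimately show ?thesis by simp
  qed
  have ne: "?P \<noteq> {}"
  \<comment> \<open>Parts of a partition are nonempty, so an empty space admits only the empty
    partition.\<close>
  proof (cases "space \<mu> = {}")
    case True
    then have "{} \<in> ?P" by (simp add: partition_on_def)
    then show ?thesis by blast
  next
    case False
    then have "{space \<mu>} \<in> ?P" by (auto simp: partition_on_def)
    then show ?thesis by blast
  qed
  have "(\<lambda>P. \<Sum>A\<in>P. \<bar>measure \<mu> A\<bar>) ` ?P = {measure \<mu> (space \<mu>)}"
    using ne sum by auto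
  then show ?thesis by (simp add: tv_norm_def)
qed

lemma tv_norm_pos_radon: "\<mu> \<in> pos_radon_measures X \<Longrightarrow> tv_norm \<mu> = measure \<mu> (topspace X)"
  using tv_norm_finite_measure[of \<mu>] pos_radon_measuresD[of \<mu> X] by simp

text \<open>By the Riesz representation theorem, these are the measures of mass at most \<open>m\<close>.\<close>

definition positive_functionals :: "'a topology \<Rightarrow> real \<Rightarrow> (('a \<Rightarrow> real) \<Rightarrow> real) set" where
  "positive_functionals X m = {L \<in> extensional (continuous_functions X).
     (\<forall>f\<in>continuous_functions X. \<forall>g\<in>continuous_functions X. L (\<lambda>x. f x + g x) = L f + L g) \<and>
     (\<forall>f\<in>continuous_functions X. \<forall>c. L (\<lambda>x. c * f x) = c * L f) \<and>
     (\<forall>f\<in>continuous_functions X. (\<forall>x\<in>topspace X. 0 \<le> f x) \<longrightarrow> 0 \<le> L f) \<and>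
     L (\<lambda>_. 1) \<le> m}"

lemma continuous_functionsI: "continuous_map X euclideanreal f \<Longrightarrow> f \<in> continuous_functions X"
  by (simp add: continuous_functions_def)

lemma positive_functional_positive_functionals:
  assumes "compact_space X" "normal_space X" "L \<in> positive_functionals X m"
  shows "positive_functional X L"
  using assms by unfold_locales (auto simp: positive_functionals_def continuous_functions_def)

text \<open>Every defining condition involves finitely many values \<open>L f\<close>, which are
  coordinates of the product, and requires a continuous expression in them to lie in a closed
  set.\<close>

lemma closedin_positive_functionals:
  defines "P \<equiv> \<lambda>X. product_topology (\<lambda>_. euclideanreal) (continuous_functions X)"
  shows "closedin (P X) (positive_functionals X m)"
proof -
  let ?C = "continuous_functions X"
  have one: "(\<lambda>_. 1) \<in> ?C" by (simp add: continuous_functions_def)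
  have addC: "(\<lambda>x. f x + g x) \<in> ?C" if "f \<in> ?C" "g \<in> ?C" for f g
    using that by (auto simp: continuous_functions_def intro: continuous_map_add)
  have scaleC: "(\<lambda>x. c * f x) \<in> ?C" if "f \<in> ?C" for f c
    using that by (auto simp: continuous_functions_def intro: continuous_map_real_mult)
  have proj: "continuous_map (P X) euclideanreal (\<lambda>L. L f)" if "f \<in> ?C" for f
    unfolding P_def by (rule continuous_map_product_projection[OF that])
  have top: "topspace (P X) = extensional ?C"
    by (simp add: P_def PiE_def)
  have ne: "?C \<noteq> {}" using one by blast
  note pre = closedin_continuous_map_preimage[where Y = euclideanreal]
  have 1: "closedin (P X) {L \<in> topspace (P X). L (\<lambda>x. f x + g x) - L f - L g \<in> {0}}"
    if fg: "f \<in> ?C" "g \<in> ?C" for f g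
    using addC[OF fg] fg by (intro pre continuous_map_diff proj) auto
  have 2: "closedin (P X) {L \<in> topspace (P X). L (\<lambda>x. c * f x) - c * L f \<in> {0}}"
    if f: "f \<in> ?C" for f c
    using scaleC[OF f] f by (intro pre continuous_map_diff continuous_map_real_mult_left proj) auto
  have 3: "closedin (P X) {L \<in> topspace (P X). L f \<in> {0..}}" if "f \<in> ?C" for f
    using that by (intro pre proj) auto
  have 4: "closedin (P X) {L \<in> topspace (P X). L (\<lambda>_. 1) \<in> {..m}}"
    by (intro pre proj one) auto
  let ?N = "{f \<in> ?C. \<forall>x\<in>topspace X. 0 \<le> f x}"
  have neN: "?N \<noteq> {}" using one by auto
  have "positive_functionals X m =
     (\<Inter>f\<in>?C. \<Inter>g\<in>?C. {L \<in> topspace (P X). L (\<lambda>x. f x + g x) - L f - L g \<in> {0}}) \<inter>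
     (\<Inter>f\<in>?C. \<Inter>c. {L \<in> topspace (P X). L (\<lambda>x. c * f x) - c * L f \<in> {0}}) \<inter>
     (\<Inter>f\<in>?N. {L \<in> topspace (P X). L f \<in> {0..}}) \<inter>
     {L \<in> topspace (P X). L (\<lambda>_. 1) \<in> {..m}}"
    unfolding top positive_functionals_def
    using ne by (auto simp: diff_diff_eq)
  then show ?thesis
    using 1 2 3 4 ne neN by (auto intro!: closedin_Int closedin_INT)
qed

text \<open>Banach-Alaoglu by Tychonoff: if \<open>f\<close> is bounded by \<open>b f\<close>,
  positivity confines \<open>L f\<close> to an interval of radius \<open>b f * m\<close>, so the set
  is a closed subset of a product of compact intervals.\<close>

lemma compactin_positive_functionals:
  assumes X: "compact_space X" "normal_space X"
  shows "compactin (product_topology (\<lambda>_. euclideanreal) (continuous_functions X)) (positive_functionals X m)"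
proof -
  let ?C = "continuous_functions X"
  have "\<forall>f\<in>?C. \<exists>b>0. \<forall>x\<in>topspace X. \<bar>f x\<bar> \<le> b"
    using continuous_map_compact_bounded[OF X(1)] unfolding continuous_functions_def
    by (metis mem_Collect_eq)
  then obtain b where b: "\<And>f. f \<in> ?C \<Longrightarrow> 0 < b f" "\<And>f x. f \<in> ?C \<Longrightarrow> x \<in> topspace X \<Longrightarrow> \<bar>f x\<bar> \<le> b f"
    by metis
  have sub: "positive_functionals X m \<subseteq> (\<Pi>\<^sub>E f\<in>?C. {- b f * m .. b f * m})"
  proof
    fix L assume L: "L \<in> positive_functionals X m"
    interpret positive_functional X L
      by (rule positive_functional_positive_functionals[OF X L])
    have m: "L (\<lambda>_. 1) \<le> m" using L by (simp add: positive_functionals_def)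
    have "- b f * m \<le> L f \<and> L f \<le> b f * m" if f: "f \<in> ?C" for f
    proof -
      have fc: "continuous_map X euclideanreal f" using f by (simp add: continuous_functions_def)
      have fb: "- b f \<le> f x \<and> f x \<le> b f" if "x \<in> topspace X" for x
        using b(2)[OF f that] by auto
      have "L (\<lambda>_. - b f) \<le> L f" "L f \<le> L (\<lambda>_. b f)"
        using fb by (auto intro!: mono fc)
      moreover have "b f * L (\<lambda>_. 1) \<le> b f * m"
        using m b(1)[OF f] by (intro mult_left_mono) auto
      ultimately show ?thesis
        using const[of "b f"] const[of "- b f"] by auto
    qed
    then show "L \<in> (\<Pi>\<^sub>E f\<in>?C. {- b f * m .. b f * m})"
      using L by (auto simp: positive_functionals_def PiE_iff)
  qed
  have "compactin (product_topology (\<lambda>_. euclideanreal) ?C) (\<Pi>\<^sub>E f\<in>?C. {- b f * m .. b f * m})"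
    by (simp add: compactin_PiE)
  then show ?thesis
    using sub closedin_positive_functionals by (rule closed_compactin)
qed

lemma radon_functional_positive_functionals:
  assumes X: "compact_space X" and \<mu>: "\<mu> \<in> pos_radon_measures X" and m: "measure \<mu> (topspace X) \<le> m"
  shows "(\<lambda>f\<in>continuous_functions X. \<integral>x. f x \<partial>\<mu>) \<in> positive_functionals X m"
proof -
  have int: "integrable \<mu> f" if "continuous_map X euclideanreal f" for f
    by (rule integrable_continuous_map_radon[OF \<mu> X that])
  have sp: "space \<mu> = topspace X" by (rule pos_radon_measuresD[OF \<mu>])
  have "(\<integral>x. 1 \<partial>\<mu>) \<le> m"
    using m by (simp add: sp)
  then show ?thesis
    unfolding positive_functionals_def
    by (auto simp: continuous_functions_def int sp continuous_map_add continuous_map_real_mult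
        intro!: integral_nonneg_AE)
qed

lemma positive_functionals_radon:
  assumes X: "compact_space X" "normal_space X" and L: "L \<in> positive_functionals X m"
  obtains \<mu> where "\<mu> \<in> pos_radon_measures X" "measure \<mu> (topspace X) = L (\<lambda>_. 1)"
    "\<And>f. continuous_map X euclideanreal f \<Longrightarrow> (\<integral>x. f x \<partial>\<mu>) = L f"
proof -
  interpret positive_functional X L
    by (rule positive_functional_positive_functionals[OF X L])
  show ?thesis
    using that[of riesz_measure] riesz_measure_radon measure_riesz_measure_space integral_riesz_measure
    by blast
qed

section \<open>The weak* topology on the cone of positive measures\<close>

lemma topspace_weak_star_measures: "topspace (weak_star_measures X) = pos_radon_measures X"
  by (auto simp: weak_star_measures_def topspace_pullback_topology)

lemma continuous_map_integral_weak_star: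
  assumes f: "continuous_map X euclideanreal f"
  shows "continuous_map (weak_star_measures X) euclideanreal (\<lambda>\<mu>. \<integral>x. f x \<partial>\<mu>)"
proof -
  have C: "f \<in> continuous_functions X" using f by (rule continuous_functionsI)
  have "continuous_map (weak_star_measures X) euclideanreal
      ((\<lambda>L. L f) \<circ> (\<lambda>\<mu>. \<lambda>f\<in>continuous_functions X. \<integral>x. f x \<partial>\<mu>))"
    unfolding weak_star_measures_def
    by (intro continuous_map_pullback continuous_map_product_projection C)
  then show ?thesis using C by (simp add: o_def)
qed

lemma continuous_map_mass_weak_star:
  "continuous_map (weak_star_measures X) euclideanreal (\<lambda>\<mu>. measure \<mu> (topspace X))"
proof -
  have "continuous_map (weak_star_measures X) euclideanreal (\<lambda>\<mu>. \<integral>x. 1 \<partial>\<mu>)"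
    by (rule continuous_map_integral_weak_star) simp
  then show ?thesis
    by (rule continuous_map_eq) (simp add: topspace_weak_star_measures pos_radon_measuresD(2))
qed

text \<open>Integration maps the measures of mass at most \<open>m\<close> onto
  \<open>positive_functionals X m\<close>; surjectivity is the Riesz theorem. Compactness is then
  pulled back along this map.\<close>

theorem compactin_bounded_measures:
  assumes X: "compact_space X" "normal_space X"
  shows "compactin (weak_star_measures X) {\<mu> \<in> pos_radon_measures X. measure \<mu> (topspace X) \<le> m}"
  unfolding weak_star_measures_def
proof (rule compactin_pullback_topology)
  let ?\<Phi> = "\<lambda>\<mu>. \<lambda>f\<in>continuous_functions X. \<integral>x. f x \<partial>\<mu>"
  have "?\<Phi> ` {\<mu> \<in> pos_radon_measures X. measure \<mu> (topspace X) \<le> m} = positive_functionals X m"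
  proof (intro antisym subsetI)
    fix L assume L: "L \<in> positive_functionals X m"
    obtain \<mu> where \<mu>: "\<mu> \<in> pos_radon_measures X" "measure \<mu> (topspace X) = L (\<lambda>_. 1)"
      "\<And>f. continuous_map X euclideanreal f \<Longrightarrow> (\<integral>x. f x \<partial>\<mu>) = L f"
      using positive_functionals_radon[OF X L] by blast
    have "L = ?\<Phi> \<mu>"
      using L \<mu>(3) by (intro extensionalityI[of L "continuous_functions X"])
        (auto simp: positive_functionals_def continuous_functions_def)
    moreover have "L (\<lambda>_. 1) \<le> m" using L by (simp add: positive_functionals_def)
    ultimately show "L \<in> ?\<Phi> ` {\<mu> \<in> pos_radon_measures X. measure \<mu> (topspace X) \<le> m}"
      using \<mu> by auto
  qed (use radon_functional_positive_functionals[OF X(1)] in blast)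
  then show "compactin (product_topology (\<lambda>_. euclideanreal) (continuous_functions X))
      (?\<Phi> ` {\<mu> \<in> pos_radon_measures X. measure \<mu> (topspace X) \<le> m})"
    using compactin_positive_functionals[OF X] by simp
qed auto

section \<open>Affine systems over compact convex sets\<close>

text \<open>Least squares: at a minimiser \<open>s\<close> of \<open>\<Sum>(f i - t i)\<^sup>2\<close>, the residuals \<open>d i = f i s - t i\<close>
  satisfy the first-order condition \<open>\<Sum>d i * (f i r - f i s) \<ge> 0\<close> for all \<open>r\<close>, and the
  solvability condition for these coefficients forces \<open>d = 0\<close>.\<close>

lemma affine_system_solvable:
  fixes f :: "'i \<Rightarrow> 'a \<Rightarrow> real"
  assumes X: "compact_space X"
    and cont: "\<And>i. continuous_map X euclideanreal (f i)"
    and conv: "\<And>r s u. r \<in> topspace X \<Longrightarrow> s \<in> topspace X \<Longrightarrow> 0 \<le> u \<Longrightarrow> u \<le> 1 \<Longrightarrow>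
      \<exists>q\<in>topspace X. \<forall>i. f i q = (1 - u) * f i s + u * f i r"
    and solv: "\<And>I d. finite I \<Longrightarrow> \<exists>s\<in>topspace X. (\<Sum>i\<in>I. d i * f i s) \<le> (\<Sum>i\<in>I. d i * t i)"
  shows "\<exists>s\<in>topspace X. \<forall>i. f i s = t i"
proof -
  have fin: "\<exists>s\<in>topspace X. \<forall>i\<in>I. f i s = t i" if I: "finite I" for I
  proof -
    define \<Phi> where "\<Phi> s = (\<Sum>i\<in>I. (f i s - t i)\<^sup>2)" for s
    have "continuous_map X euclideanreal \<Phi>"
      unfolding \<Phi>_def[abs_def] by (intro continuous_intros I cont) auto
    then have "compact (\<Phi> ` topspace X)"
      using image_compactin[of X "topspace X" euclideanreal \<Phi>] X by (simp add: compact_space_def)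
    moreover have "\<Phi> ` topspace X \<noteq> {}" using solv[of "{}"] by auto
    ultimately obtain s where s: "s \<in> topspace X" and min: "\<And>r. r \<in> topspace X \<Longrightarrow> \<Phi> s \<le> \<Phi> r"
      using compact_attains_inf[of "\<Phi> ` topspace X"] by blast
    define d where "d i = f i s - t i" for i
    obtain r where r: "r \<in> topspace X" and dr: "(\<Sum>i\<in>I. d i * f i r) \<le> (\<Sum>i\<in>I. d i * t i)"
      using solv[OF I] by blast
    let ?a = "\<Sum>i\<in>I. d i * (f i r - f i s)" and ?b = "\<Sum>i\<in>I. (f i r - f i s)\<^sup>2"
    have quad: "0 \<le> 2 * u * ?a + u\<^sup>2 * ?b" if u: "0 \<le> u" "u \<le> 1" for u
    proof -
      obtain q where q: "q \<in> topspace X" "\<And>i. f i q = (1 - u) * f i s + u * f i r"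
        using conv[OF r s u] by blast
      have "\<Phi> q = (\<Sum>i\<in>I. (d i)\<^sup>2 + (2 * u * (d i * (f i r - f i s)) + u\<^sup>2 * (f i r - f i s)\<^sup>2))"
        unfolding \<Phi>_def d_def q(2) by (intro sum.cong refl) (simp add: power2_eq_square algebra_simps)
      also have "\<dots> = \<Phi> s + (2 * u * ?a + u\<^sup>2 * ?b)"
        by (simp add: \<Phi>_def d_def sum.distrib sum_distrib_left)
      finally show ?thesis using min[OF q(1)] by simp
    qed
    have "0 \<le> ?a"
    proof (rule ccontr)
      assume a: "\<not> 0 \<le> ?a"
      have b: "0 \<le> ?b" by (rule sum_nonneg) simp
      \<comment> \<open>A step so short that \<open>u * ?b \<le> - ?a\<close>; the quadratic
        expression is then at most \<open>u * ?a\<close>, which is negative.\<close>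
      define u where "u = min 1 (- ?a / (?b + 1))"
      have u: "0 < u" "u \<le> 1" using a b by (auto simp: u_def divide_less_0_iff)
      have "u * ?b \<le> (- ?a / (?b + 1)) * ?b"
        using b by (intro mult_right_mono) (auto simp: u_def)
      also have "\<dots> \<le> - ?a"
        using a b by (simp add: field_simps)
      finally have "u * ?b \<le> - ?a" .
      then have "u * (2 * ?a + u * ?b) < 0"
        using a u by (intro mult_pos_neg) linarith+
      then show False using quad[of u] u by (simp add: power2_eq_square algebra_simps)
    qed
    moreover have "?a = (\<Sum>i\<in>I. d i * f i r) - (\<Sum>i\<in>I. d i * t i) - (\<Sum>i\<in>I. (d i)\<^sup>2)"
      unfolding sum_subtractf[symmetric] by (intro sum.cong refl) (simp add: d_def power2_eq_square algebra_simps)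
    ultimately have "(\<Sum>i\<in>I. (d i)\<^sup>2) \<le> 0" using dr by linarith
    then have "(\<Sum>i\<in>I. (d i)\<^sup>2) = 0" by (meson antisym sum_nonneg zero_le_power2)
    then have "\<forall>i\<in>I. d i = 0" using I by (simp add: sum_nonneg_eq_0_iff)
    then show ?thesis using s by (auto simp: d_def)
  qed
  \<comment> \<open>The solution sets of single equations are closed, and finite systems are
    solvable, so compactness gives a solution of all equations at once.\<close>
  let ?S = "\<lambda>i. {s \<in> topspace X. f i s \<in> {t i}}"
  have "\<Inter>(range ?S) \<noteq> {}"
  proof (rule compact_space_fip[THEN iffD1, OF X, rule_format], intro conjI ballI allI impI)
    fix C assume "C \<in> range ?S"
    then show "closedin X C"
      using closedin_continuous_map_preimage[OF cont, of "{t _}"] by auto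
  next
    fix \<F> assume "finite \<F> \<and> \<F> \<subseteq> range ?S"
    then obtain I where I: "finite I" "\<F> = ?S ` I"
      using finite_subset_image[of \<F> ?S UNIV] by blast
    then obtain s where "s \<in> topspace X" "\<forall>i\<in>I. f i s = t i"
      using fin by blast
    then have "s \<in> \<Inter>\<F>" by (simp add: I(2))
    then show "\<Inter>\<F> \<noteq> {}" by blast
  qed
  then obtain s where "s \<in> \<Inter>(range ?S)" by blast
  then have "s \<in> ?S i" for i by (rule InterD) simp
  then show ?thesis by blast
qed

section \<open>Extreme points in the weak* topology\<close>

text \<open>Evaluation embeds the dual injectively and continuously into a product of real
  lines.\<close>

lemma Hausdorff_weak_star: "Hausdorff_space (weak_star :: ('c::real_normed_vector \<Rightarrow>\<^sub>L real) topology)"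
proof -
  have "continuous_map weak_star (product_topology (\<lambda>_. euclideanreal) UNIV)
      (blinfun_apply :: ('c \<Rightarrow>\<^sub>L real) \<Rightarrow> _)"
    by (auto simp: continuous_map_componentwise_UNIV strong_operator_topology_continuous_evaluation)
  moreover have "inj_on (blinfun_apply :: ('c \<Rightarrow>\<^sub>L real) \<Rightarrow> _) (topspace weak_star)"
    by (auto simp: inj_on_def blinfun_apply_inject)
  moreover have "Hausdorff_space (product_topology (\<lambda>_::'c. euclideanreal) UNIV)"
    by (simp add: Hausdorff_space_product_topology)
  ultimately show ?thesis
    using Hausdorff_space_injective_preimage by blast
qed

lemma blinfun_eq_on_dense:
  fixes a b :: "'c::real_normed_vector \<Rightarrow>\<^sub>L real"
  assumes D: "closure D = UNIV" and eq: "\<And>p. p \<in> D \<Longrightarrow> blinfun_apply a p = blinfun_apply b p"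
  shows "a = b"
proof -
  have "closed {p. blinfun_apply a p = blinfun_apply b p}"
    by (intro closed_Collect_eq continuous_intros)
  then have "closure D \<subseteq> {p. blinfun_apply a p = blinfun_apply b p}"
    using eq by (intro closure_minimal) auto
  then show ?thesis using D by (intro blinfun_eqI) auto
qed

text \<open>The increments of \<open>p\<close> from \<open>e\<close> to the endpoints are
  nonnegative and a strictly positive combination of them vanishes, so both vanish. This is why sets
  of minimisers behave as faces.\<close>

lemma open_segment_apply_eq:
  fixes a b e :: "'c::real_normed_vector \<Rightarrow>\<^sub>L real"
  assumes e: "e \<in> open_segment a b"
    and "blinfun_apply e p \<le> blinfun_apply a p" "blinfun_apply e p \<le> blinfun_apply b p"
  shows "blinfun_apply a p = blinfun_apply e p" "blinfun_apply b p = blinfun_apply e p"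
proof -
  obtain t where t: "0 < t" "t < 1" "e = (1 - t) *\<^sub>R a + t *\<^sub>R b"
    using e by (auto simp: in_segment)
  define x y where "x = blinfun_apply a p - blinfun_apply e p" and "y = blinfun_apply b p - blinfun_apply e p"
  have "blinfun_apply e p = (1 - t) * blinfun_apply a p + t * blinfun_apply b p"
    unfolding t(3) blinfun.add_left blinfun.scaleR_left by simp
  then have "(1 - t) * x + t * y = 0"
    by (simp add: x_def y_def algebra_simps)
  moreover have "0 \<le> x" "0 \<le> y" using assms by (auto simp: x_def y_def)
  ultimately have "(1 - t) * x = 0 \<and> t * y = 0"
    using t by (intro add_nonneg_eq_0_iff[THEN iffD1]) auto
  then have "x = 0" "y = 0" using t by auto
  then show "blinfun_apply a p = blinfun_apply e p" "blinfun_apply b p = blinfun_apply e p"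
    by (simp_all add: x_def y_def)
qed

text \<open>Bauer's minimum principle. Minimising \<open>p\<close> first and then, lexicographically, the elements of a
  dense sequence yields a decreasing sequence of compact faces that shrinks to a single point.\<close>

lemma extreme_point_minimum:
  fixes B :: "('c::real_normed_vector \<Rightarrow>\<^sub>L real) set"
  assumes sep: "separable_space (euclidean :: 'c topology)"
    and B: "compactin weak_star B" and u: "u \<in> B"
  obtains e where "e extreme_point_of B" "blinfun_apply e p \<le> blinfun_apply u p"
proof -
  obtain D :: "'c set" where "countable D" and D: "closure D = UNIV"
    using sep by (auto simp: separable_space_def)
  then have "D \<noteq> {}" by auto
  \<comment> \<open>Index 0 is reserved for \<open>p\<close>, which is minimised first; an
    enumeration of the dense set follows.\<close>
  define q where "q n = (case n of 0 \<Rightarrow> p | Suc k \<Rightarrow> from_nat_into D k)" for n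
  have Dq: "D \<subseteq> range q"
  proof
    fix x assume "x \<in> D"
    then obtain k where "from_nat_into D k = x"
      using from_nat_into_surj[OF \<open>countable D\<close>] by blast
    then have "x = q (Suc k)" by (simp add: q_def)
    then show "x \<in> range q" by blast
  qed
  define A where "A = rec_nat B (\<lambda>n A. {v \<in> A. \<forall>w\<in>A. blinfun_apply v (q n) \<le> blinfun_apply w (q n)})"
  have A0: "A 0 = B" by (simp add: A_def)
  have AS: "A (Suc n) = {v \<in> A n. \<forall>w\<in>A n. blinfun_apply v (q n) \<le> blinfun_apply w (q n)}" for n
    by (simp add: A_def)
  have A: "compactin weak_star (A n) \<and> A n \<noteq> {}" for n
  proof (induction n)
    case 0
    then show ?case using B u by (auto simp: A0)
  next
    case (Suc n)
    let ?f = "\<lambda>v. blinfun_apply v (q n)"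
    have cont: "continuous_map weak_star euclideanreal ?f"
      by (rule strong_operator_topology_continuous_evaluation)
    have "compact (?f ` A n)"
      using image_compactin[OF _ cont] Suc by auto
    then obtain v where v: "v \<in> A n" "\<And>w. w \<in> A n \<Longrightarrow> ?f v \<le> ?f w"
      using compact_attains_inf[of "?f ` A n"] Suc by blast
    have "A (Suc n) = A n \<inter> {w \<in> topspace weak_star. ?f w \<in> {..?f v}}"
      unfolding AS using v by (auto simp: strong_operator_topology_topspace intro: order_trans)
    moreover have "closedin weak_star {w \<in> topspace weak_star. ?f w \<in> {..?f v}}"
      by (rule closedin_continuous_map_preimage[OF cont]) simp
    ultimately have "compactin weak_star (A (Suc n))"
      using Suc by (simp add: compact_Int_closedin)
    moreover have "v \<in> A (Suc n)" using v by (simp add: AS)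
    ultimately show ?case by blast
  qed
  have dec: "decseq A"
    by (rule decseq_SucI) (auto simp: AS)
  then have AB: "A n \<subseteq> B" for n
    using A0 by (metis decseq_def le0)
  have "(\<Inter>n. A n) \<noteq> {}"
  proof (rule compact_space_imp_nest)
    show "compact_space (subtopology weak_star B)"
      using B by (simp add: compact_space_subtopology)
    show "closedin (subtopology weak_star B) (A n)" for n
      using A compactin_imp_closedin[OF Hausdorff_weak_star] AB
      by (metis closedin_subset_topspace)
  qed (use A dec in auto)
  then obtain e where e: "\<And>n. e \<in> A n" by blast
  have eB: "e \<in> B" using e[of 0] by (simp add: A0)
  have emin: "blinfun_apply e (q n) \<le> blinfun_apply w (q n)" if "w \<in> A n" for n w
    using e[of "Suc n"] that by (simp add: AS)
  have "e \<notin> open_segment a b" if ab: "a \<in> B" "b \<in> B" for a b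
  proof
    assume seg: "e \<in> open_segment a b"
    \<comment> \<open>If \<open>e\<close> lies strictly inside a segment of \<open>B\<close>, its
      endpoints stay in every face. They then agree with \<open>e\<close> on a dense set, so the
      segment is degenerate.\<close>
    have "a \<in> A n \<and> b \<in> A n" for n
    proof (induction n)
      case 0
      then show ?case using ab by (simp add: A0)
    next
      case (Suc n)
      then have "blinfun_apply a (q n) = blinfun_apply e (q n)" "blinfun_apply b (q n) = blinfun_apply e (q n)"
        using open_segment_apply_eq[OF seg emin emin] by blast+
      then show ?case using Suc emin by (simp add: AS)
    qed
    then have "blinfun_apply a (q n) = blinfun_apply b (q n)" for n
      using open_segment_apply_eq[OF seg emin emin] by metis
    then have "a = b"
      using Dq by (intro blinfun_eq_on_dense[OF D]) blast
    then show False using seg by simp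
  qed
  then have "e extreme_point_of B"
    using eB by (simp add: extreme_point_of_def)
  moreover have "blinfun_apply e p \<le> blinfun_apply u p"
    using emin[of u 0] u by (simp add: A0 q_def)
  ultimately show ?thesis by (rule that)
qed

section \<open>Measures on the extremal points\<close>

locale regularised_problem =
  fixes K :: "('c::banach \<Rightarrow>\<^sub>L real) \<Rightarrow> 'y::real_inner" and G :: "('c \<Rightarrow>\<^sub>L real) \<Rightarrow> ennreal"
  assumes separable: "separable_space (euclidean :: 'c topology)"
    and K_linear: "linear K"
    and K_continuous: "continuous_map weak_star weak_topology K"
    and G_convex: "\<And>u v t. 0 \<le> t \<Longrightarrow> t \<le> 1 \<Longrightarrow>
      G ((1 - t) *\<^sub>R u + t *\<^sub>R v) \<le> ennreal (1 - t) * G u + ennreal t * G v"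
    and G_homogeneous: "\<And>l u. 0 \<le> l \<Longrightarrow> G (l *\<^sub>R u) = ennreal l * G u"
    and G_sublevels_compact: "\<And>\<alpha>::real. 0 \<le> \<alpha> \<Longrightarrow> compactin weak_star {u. G u \<le> ennreal \<alpha>}"
begin

section \<open>The unit ball of the regulariser and the closure of its extremal points\<close>

abbreviation "B \<equiv> unit_sublevel G"

abbreviation "X \<equiv> ext_space G"

lemma compactin_B: "compactin weak_star B"
  using G_sublevels_compact[of 1] by (simp add: unit_sublevel_def)

lemma ext_closure_subset: "ext_closure G \<subseteq> B"
proof -
  have "ext_points B \<subseteq> B" by (auto simp: ext_points_def extreme_point_of_def)
  then show ?thesis
    unfolding ext_closure_def
    using compactin_imp_closedin[OF Hausdorff_weak_star compactin_B] by (rule closure_of_minimal)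
qed

lemma topspace_X: "topspace X = ext_closure G"
  by (simp add: ext_space_def strong_operator_topology_topspace)

lemma compact_X: "compact_space X"
proof -
  have "closedin weak_star (ext_closure G)"
    unfolding ext_closure_def by (rule closedin_closure_of)
  then show ?thesis
    unfolding ext_space_def
    by (intro compact_space_subtopology closed_compactin[OF compactin_B ext_closure_subset])
qed

lemma normal_X: "normal_space X"
proof -
  have "Hausdorff_space X"
    unfolding ext_space_def by (rule Hausdorff_space_subtopology[OF Hausdorff_weak_star])
  with compact_X show ?thesis
    using compact_Hausdorff_or_regular_imp_normal_space by blast
qed

lemma continuous_map_X: "continuous_map weak_star Y f \<Longrightarrow> continuous_map X Y f"
  unfolding ext_space_def by (rule continuous_map_from_subtopology)

lemmas continuous_evaluation_X =
  continuous_map_X[OF strong_operator_topology_continuous_evaluation]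

lemma continuous_K_inner: "continuous_map weak_star euclideanreal (\<lambda>v. K v \<bullet> y)"
proof -
  have "continuous_map weak_topology euclideanreal ((\<lambda>f. f y) \<circ> (\<lambda>z::'y. \<lambda>y. z \<bullet> y))"
    unfolding weak_topology_def
    by (intro continuous_map_pullback continuous_map_product_projection) simp
  then show ?thesis
    using continuous_map_compose[OF K_continuous] by (simp add: o_def)
qed

lemma G_zero: "G 0 = 0"
  using G_homogeneous[of 0 0] by simp

text \<open>All multiples \<open>real n *\<^sub>R u\<close> stay in the compact zero sublevel set,
  on which evaluation at \<open>p\<close> is bounded; hence \<open>u\<close> vanishes at
  \<open>p\<close>.\<close>

lemma G_eq_0D:
  assumes "G u = 0"
  shows "u = 0"
proof (rule blinfun_eqI)
  fix p
  have comp: "compactin weak_star {u. G u \<le> 0}"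
    using G_sublevels_compact[of 0] by simp
  have "compact ((\<lambda>v. blinfun_apply v p) ` {u. G u \<le> 0})"
    using image_compactin[OF comp strong_operator_topology_continuous_evaluation] by simp
  then obtain b where b: "\<And>v. G v = 0 \<Longrightarrow> \<bar>blinfun_apply v p\<bar> \<le> b"
    using compact_imp_bounded bounded_iff by (metis (mono_tags, lifting) imageI le_zero_eq mem_Collect_eq real_norm_def)
  have "real n * \<bar>blinfun_apply u p\<bar> \<le> b" for n
    using b[of "real n *\<^sub>R u"] assms by (simp add: G_homogeneous blinfun.scaleR_left abs_mult)
  then show "blinfun_apply u p = blinfun_apply 0 p"
    using real_archimedian_rdiv_eq_0[of "\<bar>blinfun_apply u p\<bar>" b] b[OF assms] by force
qed

lemma convex_combination_B:
  assumes "u \<in> B" "v \<in> B" "0 \<le> t" "t \<le> 1"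
  shows "(1 - t) *\<^sub>R u + t *\<^sub>R v \<in> B"
proof -
  have "G ((1 - t) *\<^sub>R u + t *\<^sub>R v) \<le> ennreal (1 - t) * G u + ennreal t * G v"
    using assms by (intro G_convex)
  also have "\<dots> \<le> ennreal (1 - t) * 1 + ennreal t * 1"
    using assms by (intro add_mono mult_left_mono) (auto simp: unit_sublevel_def)
  also have "\<dots> = 1"
    using assms by (simp flip: ennreal_plus)
  finally show ?thesis by (simp add: unit_sublevel_def)
qed

text \<open>Krein--Milman in integral form. The conditions on \<open>\<mu>\<close> are solved in the compact set of states
  on \<open>C(\<B>)\<close>; the point evaluation at the extreme point given by Bauer's principle shows that they are
  solvable.\<close>

lemma representing_measure:
  assumes u: "u \<in> B" and m: "0 \<le> m"
  obtains \<mu> where "\<mu> \<in> pos_radon_measures X" "measure \<mu> (topspace X) = m"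
    "\<And>p. (\<integral>v. blinfun_apply v p \<partial>\<mu>) = m * blinfun_apply u p"
proof -
  let ?C = "continuous_functions X"
  let ?T = "product_topology (\<lambda>_. euclideanreal) ?C"
  \<comment> \<open>The states: positive functionals of mass exactly one.\<close>
  let ?S = "positive_functionals X 1 \<inter> {L \<in> topspace ?T. L (\<lambda>_. 1) \<in> {1}}"
  have one: "(\<lambda>_. 1) \<in> ?C" by (simp add: continuous_functions_def)
  have ev: "(\<lambda>v. blinfun_apply v p) \<in> ?C" for p
    using continuous_evaluation_X by (simp add: continuous_functions_def)
  have "closedin ?T {L \<in> topspace ?T. L (\<lambda>_. 1) \<in> {1}}"
    by (intro closedin_continuous_map_preimage[where Y = euclideanreal] continuous_map_product_projection one) simp
  then have S: "compactin ?T ?S"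
    by (intro compact_Int_closedin compactin_positive_functionals compact_X normal_X)
  have topS: "topspace (subtopology ?T ?S) = ?S"
    by auto
  have memS: "L \<in> ?S \<longleftrightarrow> L \<in> positive_functionals X 1 \<and> L (\<lambda>_. 1) = 1" for L
    by (auto simp: positive_functionals_def PiE_def)
  have "\<exists>L\<in>topspace (subtopology ?T ?S). \<forall>p. L (\<lambda>v. blinfun_apply v p) = blinfun_apply u p"
  proof (rule affine_system_solvable)
    show "compact_space (subtopology ?T ?S)"
      using S by (rule compact_space_subtopology)
    show "continuous_map (subtopology ?T ?S) euclideanreal (\<lambda>L. L (\<lambda>v. blinfun_apply v p))" for p
      by (intro continuous_map_from_subtopology continuous_map_product_projection ev)
  next
    fix L M :: "(('c \<Rightarrow>\<^sub>L real) \<Rightarrow> real) \<Rightarrow> real" and t :: real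
    assume "M \<in> topspace (subtopology ?T ?S)" "L \<in> topspace (subtopology ?T ?S)" and t: "0 \<le> t" "t \<le> 1"
    then have LM: "L \<in> positive_functionals X 1" "M \<in> positive_functionals X 1"
      "L (\<lambda>_. 1) = 1" "M (\<lambda>_. 1) = 1"
      unfolding topS memS by auto
    let ?Q = "\<lambda>f\<in>?C. (1 - t) * L f + t * M f"
    have "?Q \<in> positive_functionals X 1"
      using LM t one unfolding positive_functionals_def
      by (auto simp: continuous_functions_def continuous_map_add continuous_map_real_mult_left
          intro!: add_nonneg_nonneg mult_nonneg_nonneg) (simp_all add: algebra_simps)
    moreover have "?Q (\<lambda>_. 1) = 1" using LM one by simp
    ultimately have "?Q \<in> topspace (subtopology ?T ?S)"
      unfolding topS memS by blast
    moreover have "\<forall>p. ?Q (\<lambda>v. blinfun_apply v p) =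
        (1 - t) * L (\<lambda>v. blinfun_apply v p) + t * M (\<lambda>v. blinfun_apply v p)"
      using ev by simp
    ultimately show "\<exists>Q\<in>topspace (subtopology ?T ?S). \<forall>p. Q (\<lambda>v. blinfun_apply v p) =
        (1 - t) * L (\<lambda>v. blinfun_apply v p) + t * M (\<lambda>v. blinfun_apply v p)"
      by blast
  next
    fix I :: "'c set" and d
    assume "finite I"
    \<comment> \<open>A finite combination of evaluations is evaluation at one element of the
      predual, to which the minimum principle applies.\<close>
    let ?p = "\<Sum>p\<in>I. d p *\<^sub>R p"
    have app: "(\<Sum>p\<in>I. d p * blinfun_apply v p) = blinfun_apply v ?p" for v :: "'c \<Rightarrow>\<^sub>L real"
      by (simp add: blinfun.sum_right blinfun.scaleR_right)
    obtain e where e: "e extreme_point_of B" "blinfun_apply e ?p \<le> blinfun_apply u ?p"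
      using extreme_point_minimum[OF separable compactin_B u] by blast
    then have eX: "e \<in> topspace X"
      unfolding topspace_X ext_closure_def
      by (intro subsetD[OF closure_of_subset]) (auto simp: ext_points_def strong_operator_topology_topspace)
    let ?E = "\<lambda>f\<in>?C. f e"
    have "?E \<in> positive_functionals X 1"
      using eX one unfolding positive_functionals_def
      by (auto simp: continuous_functions_def continuous_map_add continuous_map_real_mult_left)
    moreover have "?E (\<lambda>_. 1) = 1" using one by simp
    ultimately have "?E \<in> topspace (subtopology ?T ?S)"
      unfolding topS memS by blast
    moreover have "(\<Sum>p\<in>I. d p * ?E (\<lambda>v. blinfun_apply v p)) \<le> (\<Sum>p\<in>I. d p * blinfun_apply u p)"
      using e(2) ev by (simp add: app)
    ultimately show "\<exists>L\<in>topspace (subtopology ?T ?S).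
        (\<Sum>p\<in>I. d p * L (\<lambda>v. blinfun_apply v p)) \<le> (\<Sum>p\<in>I. d p * blinfun_apply u p)"
      by blast
  qed
  then obtain L where L: "L \<in> positive_functionals X 1" "L (\<lambda>_. 1) = 1"
    and Lp: "\<And>p. L (\<lambda>v. blinfun_apply v p) = blinfun_apply u p"
    unfolding topS memS by blast
  \<comment> \<open>Rescaling the state gives mass \<open>m\<close>, with \<open>m = 0\<close>
    allowed; restriction to \<open>?C\<close> keeps it extensional.\<close>
  let ?M = "\<lambda>f\<in>?C. m * L f"
  have "?M \<in> positive_functionals X m"
    using L m one unfolding positive_functionals_def
    by (auto simp: continuous_functions_def continuous_map_add continuous_map_real_mult_left algebra_simps
        intro!: mult_nonneg_nonneg)
  then obtain \<mu> where "\<mu> \<in> pos_radon_measures X" "measure \<mu> (topspace X) = ?M (\<lambda>_. 1)"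
    "\<And>f. continuous_map X euclideanreal f \<Longrightarrow> (\<integral>x. f x \<partial>\<mu>) = ?M f"
    by (rule positive_functionals_radon[OF compact_X normal_X]) blast
  then show ?thesis
    using that[of \<mu>] one ev continuous_evaluation_X by (simp add: L Lp)
qed

text \<open>Testing against \<open>\<C>\<close> and against \<open>K\<close> at once avoids representing the weak* continuous functionals
  \<open>u \<mapsto> K u \<bullet> y\<close> by elements of \<open>\<C>\<close>.\<close>

lemma barycenter:
  assumes \<mu>: "\<mu> \<in> pos_radon_measures X"
  obtains u where "G u \<le> ennreal (measure \<mu> (topspace X))"
    "\<And>p. blinfun_apply u p = (\<integral>v. blinfun_apply v p \<partial>\<mu>)" "\<And>y. K u \<bullet> y = (\<integral>v. K v \<bullet> y \<partial>\<mu>)"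
proof -
  note D = pos_radon_measuresD[OF \<mu>]
  interpret finite_measure \<mu> by (rule D)
  let ?m = "measure \<mu> (topspace X)"
  have K0: "K 0 = 0" using K_linear by (rule linear_0)
  show ?thesis
  proof (cases "?m = 0")
    case True
    then have "emeasure \<mu> (space \<mu>) = 0"
      by (simp add: D(2) emeasure_eq_measure)
    then have "AE x in \<mu>. f x = (0::real)" for f
      by (intro AE_I[of _ _ "space \<mu>"]) auto
    then have "(\<integral>x. f x \<partial>\<mu>) = 0" for f :: "_ \<Rightarrow> real"
      by (rule integral_eq_zero_AE)
    then show ?thesis
      using that[of 0] by (simp add: G_zero K0)
  next
    case False
    then have m: "0 < ?m" by (simp add: zero_less_measure_iff)
    \<comment> \<open>The sum type merges the two families of test functionals into one affine
      system.\<close>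
    define f where "f i v = (case i of Inl p \<Rightarrow> blinfun_apply v p | Inr y \<Rightarrow> K v \<bullet> y)"
      for i :: "'c + 'y" and v
    have fc: "continuous_map weak_star euclideanreal (f i)" for i
      using strong_operator_topology_continuous_evaluation continuous_K_inner
      by (cases i) (auto simp: f_def[abs_def])
    have f_affine: "f i (a *\<^sub>R u + b *\<^sub>R v) = a * f i u + b * f i v" for i a b u v
      using K_linear
      by (cases i) (auto simp: f_def blinfun.add_left blinfun.scaleR_left linear_add linear_scale inner_add_left)
    have fi: "integrable \<mu> (f i)" for i
      by (rule integrable_continuous_map_radon[OF \<mu> compact_X continuous_map_X[OF fc]])
    define t where "t i = (\<integral>v. f i v \<partial>\<mu>) / ?m" for i
    have topB: "topspace (subtopology weak_star B) = B"
      by (simp add: strong_operator_topology_topspace)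
    have "\<exists>u\<in>topspace (subtopology weak_star B). \<forall>i. f i u = t i"
    proof (rule affine_system_solvable)
      show "compact_space (subtopology weak_star B)"
        using compactin_B by (rule compact_space_subtopology)
      show "continuous_map (subtopology weak_star B) euclideanreal (f i)" for i
        using fc by (rule continuous_map_from_subtopology)
      show "\<exists>q\<in>topspace (subtopology weak_star B). \<forall>i. f i q = (1 - c) * f i s + c * f i r"
        if "r \<in> topspace (subtopology weak_star B)" "s \<in> topspace (subtopology weak_star B)"
          "0 \<le> c" "c \<le> 1" for r s c
        unfolding topB
        by (rule bexI[OF _ convex_combination_B[of s r c]]) (use that in \<open>auto simp: topB f_affine\<close>)
      show "\<exists>s\<in>topspace (subtopology weak_star B). (\<Sum>i\<in>I. d i * f i s) \<le> (\<Sum>i\<in>I. d i * t i)" for I d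
      \<comment> \<open>Otherwise a strict inequality would hold on all of \<open>B\<close>, hence
        almost everywhere for \<open>\<mu>\<close>. Integrating it against the positive mass
        contradicts the choice of \<open>t\<close> as normalised integrals.\<close>
      proof (rule ccontr)
        assume "\<not> (\<exists>s\<in>topspace (subtopology weak_star B). (\<Sum>i\<in>I. d i * f i s) \<le> (\<Sum>i\<in>I. d i * t i))"
        then have less: "(\<Sum>i\<in>I. d i * t i) < (\<Sum>i\<in>I. d i * f i s)" if "s \<in> B" for s
          using that unfolding topB by (meson not_le)
        have "(\<integral>s. (\<Sum>i\<in>I. d i * t i) \<partial>\<mu>) < (\<integral>s. (\<Sum>i\<in>I. d i * f i s) \<partial>\<mu>)"
        proof (rule integral_less_AE_space)
          show "integrable \<mu> (\<lambda>s. \<Sum>i\<in>I. d i * f i s)"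
            using fi by (intro Bochner_Integration.integrable_sum) simp
          show "AE s in \<mu>. (\<Sum>i\<in>I. d i * t i) < (\<Sum>i\<in>I. d i * f i s)"
            using less ext_closure_subset D(2) by (auto simp: topspace_X)
          show "emeasure \<mu> (space \<mu>) \<noteq> 0"
            using m by (simp add: D(2) emeasure_eq_measure)
        qed simp
        also have "\<dots> = (\<Sum>i\<in>I. d i * (?m * t i))"
          using m fi by (simp add: t_def)
        finally show False
          by (simp add: D(2) sum_distrib_left algebra_simps)
      qed
    qed
    then obtain u where u: "u \<in> B" "\<And>i. f i u = t i" unfolding topB by blast
    show ?thesis
    \<comment> \<open>Undoes the normalisation by the mass; homogeneity turns membership in
      \<open>B\<close> into the bound on \<open>G\<close>.\<close>
    proof (rule that[of "?m *\<^sub>R u"])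
      have "G (?m *\<^sub>R u) = ennreal ?m * G u" by (rule G_homogeneous) simp
      also have "\<dots> \<le> ennreal ?m * 1" using u(1) by (intro mult_left_mono) (auto simp: unit_sublevel_def)
      finally show "G (?m *\<^sub>R u) \<le> ennreal ?m" by simp
      show "blinfun_apply (?m *\<^sub>R u) p = (\<integral>v. blinfun_apply v p \<partial>\<mu>)" for p
        using u(2)[of "Inl p"] m by (simp add: f_def t_def blinfun.scaleR_left)
      show "K (?m *\<^sub>R u) \<bullet> y = (\<integral>v. K v \<bullet> y \<partial>\<mu>)" for y
        using u(2)[of "Inr y"] m K_linear by (simp add: f_def t_def linear_scale)
    qed
  qed
qed

section \<open>The barycenter map and its compatibility with the forward operator\<close>

lemma calI_eqI:
  assumes "\<And>p. blinfun_apply u p = (\<integral>v. blinfun_apply v p \<partial>\<mu>)"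
  shows "calI \<mu> = u"
  unfolding calI_def
proof (rule the_equality)
  show "w = u" if "\<forall>p. blinfun_apply w p = (\<integral>v. blinfun_apply v p \<partial>\<mu>)" for w
    using that assms by (intro blinfun_eqI) simp
qed (use assms in blast)

lemma calK_eqI:
  assumes "\<And>y. z \<bullet> y = (\<integral>v. K v \<bullet> y \<partial>\<mu>)"
  shows "calK K \<mu> = z"
  unfolding calK_def
proof (rule the_equality)
  show "w = z" if "\<forall>y. w \<bullet> y = (\<integral>v. K v \<bullet> y \<partial>\<mu>)" for w
  proof -
    have "\<forall>y. w \<bullet> y = z \<bullet> y" using that assms by simp
    then show ?thesis using vector_eq_rdot by blast
  qed
qed (use assms in blast)

text \<open>A single barycenter \<open>u\<close> satisfies both defining identities, so
  \<open>calI \<mu>\<close> is \<open>u\<close> and \<open>calK K \<mu>\<close> is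
  \<open>K u\<close>.\<close>

lemma
  assumes "\<mu> \<in> pos_radon_measures X"
  shows G_calI_le: "G (calI \<mu>) \<le> ennreal (measure \<mu> (topspace X))"
    and calK_eq: "calK K \<mu> = K (calI \<mu>)"
    and calK_inner: "calK K \<mu> \<bullet> y = (\<integral>v. K v \<bullet> y \<partial>\<mu>)"
proof -
  obtain u where u: "G u \<le> ennreal (measure \<mu> (topspace X))"
    "\<And>p. blinfun_apply u p = (\<integral>v. blinfun_apply v p \<partial>\<mu>)" "\<And>y. K u \<bullet> y = (\<integral>v. K v \<bullet> y \<partial>\<mu>)"
    using barycenter[OF assms] by blast
  have "calI \<mu> = u" using u(2) by (rule calI_eqI)
  moreover have "calK K \<mu> = K u" using u(3) by (rule calK_eqI)
  ultimately show "G (calI \<mu>) \<le> ennreal (measure \<mu> (topspace X))" "calK K \<mu> = K (calI \<mu>)"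
    "calK K \<mu> \<bullet> y = (\<integral>v. K v \<bullet> y \<partial>\<mu>)"
    using u by simp_all
qed

text \<open>With \<open>m\<close> the value of \<open>G u\<close>, write \<open>u\<close> as
  \<open>m\<close> times an element \<open>w\<close> of \<open>B\<close> and represent
  \<open>w\<close> by a measure of mass \<open>m\<close>. For \<open>m = 0\<close> this relies on
  \<open>G\<close> vanishing only at the origin.\<close>

lemma exists_calI_eq:
  assumes "G u < \<infinity>"
  obtains \<mu> where "\<mu> \<in> pos_radon_measures X" "calI \<mu> = u" "ennreal (measure \<mu> (topspace X)) = G u"
proof -
  obtain m where m: "0 \<le> m" "G u = ennreal m"
    using assms by (cases "G u") auto
  obtain w where w: "w \<in> B" "u = m *\<^sub>R w"
  proof (cases "m = 0")
    case True
    then have "u = 0" using m G_eq_0D by simp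
    then show ?thesis using that[of 0] by (simp add: unit_sublevel_def G_zero)
  next
    case False
    then have "G ((1 / m) *\<^sub>R u) = 1"
      using m by (simp add: G_homogeneous flip: ennreal_mult)
    then show ?thesis using that[of "(1 / m) *\<^sub>R u"] False by (simp add: unit_sublevel_def)
  qed
  obtain \<mu> where \<mu>: "\<mu> \<in> pos_radon_measures X" "measure \<mu> (topspace X) = m"
    "\<And>p. (\<integral>v. blinfun_apply v p \<partial>\<mu>) = m * blinfun_apply w p"
    using representing_measure[OF w(1) m(1)] by blast
  have "calI \<mu> = u"
    by (rule calI_eqI) (simp add: \<mu>(3) w(2) blinfun.scaleR_left)
  then show ?thesis using that \<mu> m by simp
qed

end

section \<open>Minimisers\<close>

text \<open>Without a minimiser, the open sets where \<open>j\<close> exceeds some value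
  \<open>j y\<close> would cover the compact sublevel set. In a finite subcover, the
  \<open>y\<close> with least value would satisfy \<open>j y < j y\<close>.\<close>

lemma lsc_attains_min:
  fixes j :: "'a \<Rightarrow> 'b::linorder"
  assumes lsc: "lsc_on_topology T j" and c: "compactin T {x \<in> topspace T. j x \<le> a}"
    and x0: "x0 \<in> topspace T" "j x0 \<le> a"
  shows "\<exists>x. is_arg_min j (\<lambda>x. x \<in> topspace T) x"
proof (rule ccontr)
  assume no: "\<not> ?thesis"
  then have lt: "\<exists>y\<in>topspace T. j y < j x" if "x \<in> topspace T" for x
    using that by (auto simp: is_arg_min_def)
  let ?S = "{x \<in> topspace T. j x \<le> a}" and ?U = "\<lambda>y. {x \<in> topspace T. j y < j x}"
  have "\<forall>U\<in>?U ` topspace T. openin T U"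
    using lsc by (auto simp: lsc_on_topology_def)
  moreover have "?S \<subseteq> \<Union>(?U ` topspace T)"
    using lt by auto
  ultimately obtain \<F> where "finite \<F>" "\<F> \<subseteq> ?U ` topspace T" and \<F>: "?S \<subseteq> \<Union>\<F>"
    using c unfolding compactin_def by meson
  then obtain Y where Y: "finite Y" "Y \<subseteq> topspace T" "\<F> = ?U ` Y"
    by (meson finite_subset_image)
  have "Y \<noteq> {}" using \<F> Y x0 by auto
  then have "Min (j ` Y) \<in> j ` Y" using Y by simp
  then obtain y where y: "y \<in> Y" "j y = Min (j ` Y)" by auto
  have cover: "j y < j x" if x: "x \<in> ?S" for x
  proof -
    obtain z where "z \<in> Y" "j z < j x" using \<F> Y(3) x by blast
    moreover have "j y \<le> j z" using y Y(1) \<open>z \<in> Y\<close> by simp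
    ultimately show ?thesis by simp
  qed
  \<comment> \<open>Comparison with \<open>x0\<close> places \<open>y\<close> itself in the sublevel
    set, so the cover applies to it.\<close>
  have "j y < j x0" using x0 by (intro cover) simp
  then have "j y \<le> a" using x0 by simp
  then have "j y < j y" using y Y by (intro cover) auto
  then show False by simp
qed

text \<open>Restriction to the line through \<open>z0\<close> and \<open>z\<close> reduces the claim
  to the tangent inequality for convex functions of one real variable.\<close>

lemma convex_on_above_tangent_GDERIV:
  fixes F :: "'y::real_inner \<Rightarrow> real"
  assumes F: "convex_on UNIV F" and g: "GDERIV F z0 :> g"
  shows "F z0 + g \<bullet> (z - z0) \<le> F z"
proof -
  let ?h = "\<lambda>t::real. F (z0 + t *\<^sub>R (z - z0))"
  have "convex_on UNIV ?h"
  proof (rule convex_onI)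
    fix t x y :: real assume t: "0 < t" "t < 1"
    have "z0 + ((1 - t) *\<^sub>R x + t *\<^sub>R y) *\<^sub>R (z - z0) =
        (1 - t) *\<^sub>R (z0 + x *\<^sub>R (z - z0)) + t *\<^sub>R (z0 + y *\<^sub>R (z - z0))"
      by (simp add: algebra_simps)
    then show "?h ((1 - t) *\<^sub>R x + t *\<^sub>R y) \<le> (1 - t) * ?h x + t * ?h y"
      using convex_onD[OF F, of t] t by simp
  qed simp
  moreover have "(?h has_field_derivative (g \<bullet> (z - z0))) (at 0)"
  proof -
    have "(F has_derivative (\<lambda>v. v \<bullet> g)) (at (z0 + 0 *\<^sub>R (z - z0)))"
      using g by (simp add: gderiv_def)
    moreover have "((\<lambda>t::real. z0 + t *\<^sub>R (z - z0)) has_derivative (\<lambda>t. t *\<^sub>R (z - z0))) (at 0)"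
      by (auto intro!: derivative_eq_intros)
    ultimately have "(?h has_derivative (\<lambda>t. (t *\<^sub>R (z - z0)) \<bullet> g)) (at 0)"
      by (rule has_derivative_compose[rotated])
    then show ?thesis
      by (rule has_derivative_imp_has_field_derivative) (simp add: inner_commute)
  qed
  ultimately have "?h 1 - ?h 0 \<ge> (g \<bullet> (z - z0)) * (1 - 0)"
    by (intro convex_on_imp_above_tangent[of UNIV]) auto
  then show ?thesis by simp
qed

section \<open>Semicontinuity and compact sublevel sets of the lifted functional\<close>

context regularised_problem
begin

text \<open>The tangent of \<open>F\<close> at \<open>calK K \<mu>0\<close>, plus the mass, is a
  weak* continuous minorant \<open>?l\<close> of \<open>j_fun F K\<close> that touches it at
  \<open>\<mu>0\<close>. The set where \<open>?l\<close> exceeds \<open>a\<close> is the required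
  open neighbourhood.\<close>

lemma lsc_j:
  assumes F: "convex_on UNIV F" and g: "\<And>y. GDERIV F y :> gradF y"
  shows "lsc_on_topology (weak_star_measures X) (j_fun F K)"
proof -
  let ?T = "weak_star_measures X"
  have "openin ?T {\<mu> \<in> topspace ?T. a < j_fun F K \<mu>}" for a
  proof (subst openin_subopen, intro ballI)
    fix \<mu>0 assume "\<mu>0 \<in> {\<mu> \<in> topspace ?T. a < j_fun F K \<mu>}"
    then have \<mu>0: "\<mu>0 \<in> topspace ?T" "a < j_fun F K \<mu>0" by auto
    let ?z = "calK K \<mu>0"
    let ?l = "\<lambda>\<mu>. F ?z + ((\<integral>v. K v \<bullet> gradF ?z \<partial>\<mu>) - gradF ?z \<bullet> ?z) + measure \<mu> (topspace X)"
    have inner: "(\<integral>v. K v \<bullet> gradF ?z \<partial>\<mu>) = gradF ?z \<bullet> calK K \<mu>" if "\<mu> \<in> topspace ?T" for \<mu>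
      using calK_inner[of \<mu> "gradF ?z"] that
      by (simp add: topspace_weak_star_measures inner_commute[of "gradF ?z"])
    have tv: "tv_norm \<mu> = measure \<mu> (topspace X)" if "\<mu> \<in> topspace ?T" for \<mu>
      using tv_norm_pos_radon[of \<mu> X] that by (simp add: topspace_weak_star_measures)
    have cont: "continuous_map ?T euclideanreal ?l"
      by (intro continuous_map_add continuous_map_diff continuous_map_mass_weak_star
          continuous_map_integral_weak_star continuous_map_X continuous_K_inner) auto
    have le: "?l \<mu> \<le> j_fun F K \<mu>" if "\<mu> \<in> topspace ?T" for \<mu>
      using convex_on_above_tangent_GDERIV[OF F g, of ?z "calK K \<mu>"] inner[OF that] tv[OF that]
      by (simp add: j_fun_def inner_diff_right)
    have eq: "?l \<mu>0 = j_fun F K \<mu>0"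
      using inner[OF \<mu>0(1)] tv[OF \<mu>0(1)] by (simp add: j_fun_def)
    have "openin ?T {\<mu> \<in> topspace ?T. ?l \<mu> \<in> {a<..}}"
      by (rule openin_continuous_map_preimage[OF cont]) simp
    moreover have "\<mu>0 \<in> {\<mu> \<in> topspace ?T. ?l \<mu> \<in> {a<..}}"
      using \<mu>0 eq by simp
    moreover have "{\<mu> \<in> topspace ?T. ?l \<mu> \<in> {a<..}} \<subseteq> {\<mu> \<in> topspace ?T. a < j_fun F K \<mu>}"
      using le by fastforce
    ultimately show "\<exists>U. openin ?T U \<and> \<mu>0 \<in> U \<and> U \<subseteq> {\<mu> \<in> topspace ?T. a < j_fun F K \<mu>}"
      by blast
  qed
  then show ?thesis by (simp add: lsc_on_topology_def)
qed

text \<open>A lower bound \<open>c\<close> of \<open>F\<close> limits the mass to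
  \<open>a - c\<close>, so the sublevel set is a closed part of a compact set of measures.\<close>

lemma compactin_sublevel_j:
  assumes lsc: "lsc_on_topology (weak_star_measures X) (j_fun F K)" and F: "bdd_below (range F)"
  shows "compactin (weak_star_measures X) {\<mu> \<in> pos_radon_measures X. j_fun F K \<mu> \<le> a}"
proof -
  let ?T = "weak_star_measures X"
  obtain c where c: "\<And>z. c \<le> F z"
    using F by (auto simp: bdd_below_def)
  have "{\<mu> \<in> pos_radon_measures X. j_fun F K \<mu> \<le> a} =
      topspace ?T - {\<mu> \<in> topspace ?T. a < j_fun F K \<mu>}"
    by (auto simp: topspace_weak_star_measures)
  then have "closedin ?T {\<mu> \<in> pos_radon_measures X. j_fun F K \<mu> \<le> a}"
    using lsc by (simp add: lsc_on_topology_def closedin_diff)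
  moreover have "{\<mu> \<in> pos_radon_measures X. j_fun F K \<mu> \<le> a} \<subseteq>
      {\<mu> \<in> pos_radon_measures X. measure \<mu> (topspace X) \<le> a - c}"
  proof clarify
    fix \<mu> assume "\<mu> \<in> pos_radon_measures X" "j_fun F K \<mu> \<le> a"
    then show "measure \<mu> (topspace X) \<le> a - c"
      using c[of "calK K \<mu>"] tv_norm_pos_radon[of \<mu> X] by (simp add: j_fun_def)
  qed
  ultimately show ?thesis
    using closed_compactin compactin_bounded_measures[OF compact_X normal_X] by blast
qed

section \<open>Comparison of the two functionals and transfer of minimisers\<close>

lemma J_calI_le:
  assumes "\<mu> \<in> pos_radon_measures X"
  shows "J_fun F K G (calI \<mu>) \<le> ereal (j_fun F K \<mu>)"
proof -
  have "enn2ereal (G (calI \<mu>)) \<le> enn2ereal (ennreal (measure \<mu> (topspace X)))"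
    using G_calI_le[OF assms] unfolding less_eq_ennreal.rep_eq .
  also have "\<dots> = ereal (tv_norm \<mu>)"
    using tv_norm_pos_radon[OF assms] by simp
  finally have "J_fun F K G (calI \<mu>) \<le> ereal (F (K (calI \<mu>))) + ereal (tv_norm \<mu>)"
    unfolding J_fun_def by (rule add_left_mono)
  then show ?thesis
    by (simp add: j_fun_def calK_eq[OF assms])
qed

text \<open>As \<open>F\<close> is real-valued, finiteness of \<open>J_fun F K G u\<close> means
  finiteness of \<open>G u\<close>; a representing measure of mass \<open>G u\<close> then matches
  both terms.\<close>

lemma exists_j_eq:
  assumes "J_fun F K G u < \<infinity>"
  obtains \<mu> where "\<mu> \<in> pos_radon_measures X" "calI \<mu> = u" "ereal (j_fun F K \<mu>) = J_fun F K G u"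
proof -
  have "G u \<noteq> top"
    using assms by (auto simp: J_fun_def top_ennreal.rep_eq top_ereal_def)
  then have "G u < \<infinity>"
    by (simp add: less_top)
  then obtain \<mu> where \<mu>: "\<mu> \<in> pos_radon_measures X" "calI \<mu> = u"
    "ennreal (measure \<mu> (topspace X)) = G u"
    by (rule exists_calI_eq)
  have "ereal (j_fun F K \<mu>) = J_fun F K G u"
    unfolding j_fun_def J_fun_def calK_eq[OF \<mu>(1)] tv_norm_pos_radon[OF \<mu>(1)] \<mu>(2) \<mu>(3)[symmetric]
    by simp
  then show ?thesis using that \<mu> by blast
qed

lemma exists_j_eq_J_zero:
  obtains \<mu> where "\<mu> \<in> pos_radon_measures X" "ereal (j_fun F K \<mu>) = J_fun F K G 0"
  by (rule exists_j_eq[of F 0]) (auto simp: J_fun_def G_zero)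

text \<open>Lift \<open>u\<close> to \<open>\<mu>\<close> with equal value. Any competitor
  \<open>\<nu>\<close> has \<open>j\<close>-value at least the \<open>J\<close>-value of its
  barycenter, hence at least that of \<open>u\<close>.\<close>

lemma arg_min_j_if_arg_min_J:
  assumes "is_arg_min (J_fun F K G) (\<lambda>_. True) u"
  obtains \<mu> where "is_arg_min (j_fun F K) (\<lambda>\<mu>. \<mu> \<in> pos_radon_measures X) \<mu>" "u = calI \<mu>"
proof -
  have min: "J_fun F K G u \<le> J_fun F K G w" for w
    using assms by (auto simp: is_arg_min_def not_less)
  \<comment> \<open>Comparison with the origin, where \<open>G\<close> vanishes, excludes an
    infinite minimum.\<close>
  have "J_fun F K G u < \<infinity>"
    using min[of 0] by (rule order_le_less_trans) (simp add: J_fun_def G_zero)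
  then obtain \<mu> where \<mu>: "\<mu> \<in> pos_radon_measures X" "calI \<mu> = u" "ereal (j_fun F K \<mu>) = J_fun F K G u"
    by (rule exists_j_eq)
  have "ereal (j_fun F K \<mu>) \<le> ereal (j_fun F K \<nu>)" if "\<nu> \<in> pos_radon_measures X" for \<nu>
    unfolding \<mu>(3) using min J_calI_le[OF that] by (rule order_trans)
  then have "is_arg_min (j_fun F K) (\<lambda>\<mu>. \<mu> \<in> pos_radon_measures X) \<mu>"
    using \<mu>(1) by (auto simp: is_arg_min_def not_less)
  then show ?thesis using that \<mu>(2) by blast
qed

text \<open>Every \<open>w\<close> of finite \<open>J\<close>-value lifts to a competitor with the
  same value, so the minimum of \<open>j\<close> bounds \<open>J\<close> from below. The barycenter
  of \<open>\<mu>\<close> stays below this bound and is therefore optimal; taking \<open>w\<close>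
  to be that barycenter gives equality.\<close>

lemma
  assumes "is_arg_min (j_fun F K) (\<lambda>\<mu>. \<mu> \<in> pos_radon_measures X) \<mu>"
  shows arg_min_J_if_arg_min_j: "is_arg_min (J_fun F K G) (\<lambda>_. True) (calI \<mu>)"
    and J_calI_eq: "J_fun F K G (calI \<mu>) = ereal (j_fun F K \<mu>)"
proof -
  have \<mu>: "\<mu> \<in> pos_radon_measures X" and min: "\<And>\<nu>. \<nu> \<in> pos_radon_measures X \<Longrightarrow> j_fun F K \<mu> \<le> j_fun F K \<nu>"
    using assms by (auto simp: is_arg_min_def not_less)
  have le: "ereal (j_fun F K \<mu>) \<le> J_fun F K G w" for w
  proof (cases "J_fun F K G w < \<infinity>")
    case True
    then obtain \<nu> where "\<nu> \<in> pos_radon_measures X" "ereal (j_fun F K \<nu>) = J_fun F K G w"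
      by (rule exists_j_eq)
    then show ?thesis using min by (metis ereal_less_eq(3))
  qed auto
  show "is_arg_min (J_fun F K G) (\<lambda>_. True) (calI \<mu>)"
    using order_trans[OF J_calI_le[OF \<mu>] le] by (auto simp: is_arg_min_def not_less)
  show "J_fun F K G (calI \<mu>) = ereal (j_fun F K \<mu>)"
    using J_calI_le[OF \<mu>] le by (rule antisym)
qed

end
theorem theorem5p4:
  fixes F :: "'y::{real_inner, complete_space} \<Rightarrow> real"
    and gradF :: "'y \<Rightarrow> 'y"
    and K :: "('c::banach \<Rightarrow>\<^sub>L real) \<Rightarrow> 'y"
    and G :: "('c \<Rightarrow>\<^sub>L real) \<Rightarrow> ennreal"
  assumes C_separable: "separable_space (euclidean :: 'c topology)"
    and F_convex: "convex_on UNIV F"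
    and K_linear: "linear K"
    and K_continuous: "continuous_map weak_star weak_topology K"
    and G_convex: "\<And>u v t. 0 \<le> t \<Longrightarrow> t \<le> 1 \<Longrightarrow>
      G ((1 - t) *\<^sub>R u + t *\<^sub>R v) \<le> ennreal (1 - t) * G u + ennreal t * G v"
    and G_lsc: "lsc_on_topology weak_star G"
    and G_homogeneous: "\<And>l u. 0 \<le> l \<Longrightarrow> G (l *\<^sub>R u) = ennreal l * G u"
    and F_bounded_below: "bdd_below (range F)"
    and F_strictly_convex: "\<And>x y t. x \<noteq> y \<Longrightarrow> 0 < t \<Longrightarrow> t < 1 \<Longrightarrow>
      F ((1 - t) *\<^sub>R x + t *\<^sub>R y) < (1 - t) * F x + t * F y"
    and F_gradient: "\<And>y. GDERIV F y :> gradF y"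
    and gradF_lipschitz: "\<And>S. compact S \<Longrightarrow> \<exists>L. L-lipschitz_on S gradF"
    and G_sublevels_compact: "\<And>\<alpha>::real. 0 \<le> \<alpha> \<Longrightarrow> compactin weak_star {u. G u \<le> ennreal \<alpha>}"
    and K_weak_star_to_strong: "\<And>(u :: nat \<Rightarrow> ('c \<Rightarrow>\<^sub>L real)) u0. (\<And>k. G (u k) < \<infinity>) \<Longrightarrow>
      limitin weak_star u u0 sequentially \<Longrightarrow> (\<lambda>k. K (u k)) \<longlonglongrightarrow> K u0"
  defines "Mpos \<equiv> pos_radon_measures (ext_space G)"
    and "J \<equiv> J_fun F K G"
    and "j \<equiv> j_fun F K"
  shows "lsc_on_topology (weak_star_measures (ext_space G)) j
    \<and> (\<forall>a::real. compactin (weak_star_measures (ext_space G)) {\<mu> \<in> Mpos. j \<mu> \<le> a})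
    \<and> (\<exists>\<mu>. is_arg_min j (\<lambda>\<mu>. \<mu> \<in> Mpos) \<mu>)
    \<and> (\<forall>u. is_arg_min J (\<lambda>_. True) u \<longrightarrow>
          (\<exists>\<mu>. is_arg_min j (\<lambda>\<mu>. \<mu> \<in> Mpos) \<mu> \<and> u = calI \<mu>))
    \<and> (\<forall>\<mu>. is_arg_min j (\<lambda>\<mu>. \<mu> \<in> Mpos) \<mu> \<longrightarrow> is_arg_min J (\<lambda>_. True) (calI \<mu>))
    \<and> (\<exists>u \<mu>. is_arg_min J (\<lambda>_. True) u \<and> is_arg_min j (\<lambda>\<mu>. \<mu> \<in> Mpos) \<mu> \<and> J u = ereal (j \<mu>))"
proof -
  interpret regularised_problem K G
    by (rule regularised_problem.intro[OF C_separable K_linear K_continuous G_convex G_homogeneous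
        G_sublevels_compact])
  let ?T = "weak_star_measures (ext_space G)"
  have lsc: "lsc_on_topology ?T j"
    unfolding j_def using F_convex F_gradient by (rule lsc_j)
  have comp: "compactin ?T {\<mu> \<in> Mpos. j \<mu> \<le> a}" for a
    using compactin_sublevel_j[OF _ F_bounded_below] lsc unfolding j_def Mpos_def by blast
  have top: "topspace ?T = Mpos"
    by (simp add: Mpos_def topspace_weak_star_measures)
  \<comment> \<open>The lift of the origin shows that the cone is nonempty and fixes the level
    \<open>j \<mu>0\<close> for the direct method.\<close>
  obtain \<mu>0 where "\<mu>0 \<in> Mpos"
    unfolding Mpos_def using exists_j_eq_J_zero[of F] by blast
  then have min: "\<exists>\<mu>. is_arg_min j (\<lambda>\<mu>. \<mu> \<in> Mpos) \<mu>"
    using lsc_attains_min[OF lsc, of "j \<mu>0" \<mu>0] comp by (simp add: top)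
  moreover have "\<exists>\<mu>. is_arg_min j (\<lambda>\<mu>. \<mu> \<in> Mpos) \<mu> \<and> u = calI \<mu>" if "is_arg_min J (\<lambda>_. True) u" for u
    using arg_min_j_if_arg_min_J[of F u] that unfolding J_def j_def Mpos_def by blast
  \<comment> \<open>Applied to the minimiser already obtained, these two facts give the equality of
    the minima, attained by \<open>J\<close> at its barycenter.\<close>
  moreover have "is_arg_min J (\<lambda>_. True) (calI \<mu>)" "J (calI \<mu>) = ereal (j \<mu>)"
    if "is_arg_min j (\<lambda>\<mu>. \<mu> \<in> Mpos) \<mu>" for \<mu>
    using arg_min_J_if_arg_min_j[of F \<mu>] J_calI_eq[of F \<mu>] that unfolding J_def j_def Mpos_def by blast+
  ultimately show ?thesis
    using lsc comp by blast
qed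

end
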